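(* Let $u_0\in L^2$ (non-random), $\tau\in(0,1)$, and let $(u_n)_{n\in\mathbb{N}_0}$ be given by the splitting scheme $u_{n+1}=S(t_{n+1},t_n)\Phi_\tau(u_n)$ with initial value $u_0$, where $t_n=n\tau$. Then the $L^2$-norm is conserved: for all $n\in\mathbb{N}$, one has almost surely $$\|u_n\|_{L^2}=\|u_0\|_{L^2}.$$
   Context: $\mathbb{N}=\{1,2,\ldots\}$, $\mathbb{N}_0=\{0,1,\ldots\}$, $d\in\mathbb{N}$, $L^2=L^2(\mathbb{R}^d,\mathbb{C})$. The potential $V:\mathbb{R}^d\to\mathbb{R}$ is real-valued, continuous and bounded, and $V[u]=V\star|u|^2=\int_{\mathbb{R}^d}V(\cdot-x)|u(x)|^2\,dx$. For $t\ge0$ and $u\in L^2$, $\Phi_t(u)=e^{itV[u]}u$. $\beta=(\beta(t))_{t\ge0}$ is a standard real-valued Brownian motion on a filtered probability space satisfying the usual conditions, and for $t,s\ge0$, $S(t,s)=e^{i(\beta(t)-\beta(s))\Delta}$, i.e. $\widehat{S(t,s)v}(\zeta)=\exp(-i|\zeta|^2(\beta(t)-\beta(s)))\,\widehat v(\zeta)$, where $\widehat{\cdot}$ is the Fourier transform. *)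

theory Defs
  imports "HOL-Probability.Probability"
begin

section \<open>The space of square-integrable functions\<close>

definition square_integrable :: "(real ^ 'd \<Rightarrow> complex) \<Rightarrow> bool" where
  "square_integrable f \<longleftrightarrow>
     f \<in> borel_measurable lborel \<and> integrable lborel (\<lambda>x. (cmod (f x))\<^sup>2)"

definition l2_rel :: "(real ^ 'd \<Rightarrow> complex) \<Rightarrow> (real ^ 'd \<Rightarrow> complex) \<Rightarrow> bool" where
  "l2_rel f g \<longleftrightarrow> square_integrable f \<and> square_integrable g \<and> (AE x in lborel. f x = g x)"

quotient_type 'd l2 = "real ^ 'd \<Rightarrow> complex" / partial: l2_rel
proof (rule part_equivpI)
  show "\<exists>f :: real ^ 'd \<Rightarrow> complex. l2_rel f f"
    by (rule exI[of _ "\<lambda>_. 0"]) (simp add: l2_rel_def square_integrable_def)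
  show "symp (l2_rel :: (real ^ 'd \<Rightarrow> complex) \<Rightarrow> _)"
    by (auto simp: symp_def l2_rel_def)
  show "transp (l2_rel :: (real ^ 'd \<Rightarrow> complex) \<Rightarrow> _)"
    unfolding transp_def l2_rel_def by (auto elim: eventually_elim2)
qed

lift_definition l2_norm :: "('d::finite) l2 \<Rightarrow> real" is
  "\<lambda>f. sqrt (\<integral>x. (cmod (f x))\<^sup>2 \<partial>lborel)"
  unfolding l2_rel_def square_integrable_def
  by (auto intro!: integral_cong_AE elim: eventually_mono)

section \<open>The Fourier transform\<close>

text \<open>The transform of an integrable function, in the unitary normalisation and in angular
  frequency, so that the Laplacian has symbol \<open>- (norm \<zeta>)\<^sup>2\<close>.\<close>

definition fourier_integral :: "(real ^ 'd \<Rightarrow> complex) \<Rightarrow> real ^ 'd \<Rightarrow> complex" where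
  "fourier_integral f \<zeta> =
     of_real ((2 * pi) powr (- real CARD('d) / 2)) *
     (\<integral>x. exp (- \<i> * of_real (x \<bullet> \<zeta>)) * f x \<partial>lborel)"

text \<open>On square-integrable functions: the limit in mean of the transforms of the truncations to
  balls, which are integrable.\<close>

definition fourier :: "('d::finite) l2 \<Rightarrow> 'd l2" where
  "fourier v = (THE g.
     ((\<lambda>R::real. \<integral>\<^sup>+ \<zeta>.
         ennreal ((cmod (fourier_integral (\<lambda>x. indicator (cball 0 R) x * rep_l2 v x) \<zeta>
           - rep_l2 g \<zeta>))\<^sup>2) \<partial>lborel) \<longlongrightarrow> 0) at_top)"

section \<open>The flows of the splitting scheme\<close>

lift_definition free_multiplier :: "real \<Rightarrow> ('d::finite) l2 \<Rightarrow> 'd l2" is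
  "\<lambda>b f \<zeta>. exp (- \<i> * of_real ((norm \<zeta>)\<^sup>2 * b)) * f \<zeta>"
  unfolding l2_rel_def square_integrable_def
  by (auto simp: norm_mult elim: eventually_mono)

definition propagator :: "(real \<Rightarrow> real) \<Rightarrow> real \<Rightarrow> real \<Rightarrow> ('d::finite) l2 \<Rightarrow> 'd l2" where
  "propagator b t s v = (THE w. fourier w = free_multiplier (b t - b s) (fourier v))"

text \<open>For measurable \<open>V\<close>, in particular for continuous bounded \<open>V\<close>, neither definition below
  depends on the representative \<open>rep_l2 u\<close>.\<close>

definition potential :: "(real ^ 'd \<Rightarrow> real) \<Rightarrow> ('d::finite) l2 \<Rightarrow> real ^ 'd \<Rightarrow> real" where
  "potential V u y = (\<integral>x. V (y - x) * (cmod (rep_l2 u x))\<^sup>2 \<partial>lborel)"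

definition nonlinear_flow :: "(real ^ 'd \<Rightarrow> real) \<Rightarrow> real \<Rightarrow> ('d::finite) l2 \<Rightarrow> 'd l2" where
  "nonlinear_flow V t u =
     abs_l2 (\<lambda>x. exp (\<i> * of_real (t * potential V u x)) * rep_l2 u x)"

section \<open>Brownian motion\<close>

text \<open>Time is \<open>{0..}\<close>; values of \<open>F\<close> and \<open>\<beta>\<close> at negative times play no role, whence the \<open>max\<close>.\<close>

locale usual_filtered_prob_space =
  prob_space M + complete_measure M + filtration "space M" "\<lambda>t. F (max 0 t)"
  for M :: "'w measure" and F :: "real \<Rightarrow> 'w measure" +
  assumes sub: "\<And>t. 0 \<le> t \<Longrightarrow> subalgebra M (F t)"
    and null_sets_initial: "null_sets M \<subseteq> sets (F 0)"
    and right_continuous: "\<And>t. 0 \<le> t \<Longrightarrow> sets (F t) = (\<Inter>s\<in>{t<..}. sets (F s))"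

locale standard_brownian_motion = usual_filtered_prob_space M F
  for M :: "'w measure" and F :: "real \<Rightarrow> 'w measure" +
  fixes \<beta> :: "real \<Rightarrow> 'w \<Rightarrow> real"
  assumes adapted: "\<And>t. 0 \<le> t \<Longrightarrow> \<beta> t \<in> borel_measurable (F t)"
    and start: "AE \<omega> in M. \<beta> 0 \<omega> = 0"
    and continuous_paths: "AE \<omega> in M. continuous_on {0..} (\<lambda>t. \<beta> t \<omega>)"
    and increment_distributed: "\<And>s t. 0 \<le> s \<Longrightarrow> s < t \<Longrightarrow>
      distributed M lborel (\<lambda>\<omega>. \<beta> t \<omega> - \<beta> s \<omega>) (normal_density 0 (sqrt (t - s)))"
    and increment_indep: "\<And>s t. 0 \<le> s \<Longrightarrow> s < t \<Longrightarrow>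
      indep_set (sets (F s))
        (sets (vimage_algebra (space M) (\<lambda>\<omega>. \<beta> t \<omega> - \<beta> s \<omega>) borel))"

end

theory Submission
  imports Defs
begin

text \<open>
  Both factors of the scheme are isometries of \<open>L\<^sup>2\<close>. The nonlinear flow multiplies by a function
  of modulus one. The propagator is conjugate, under the Fourier transform, to a multiplier of
  modulus one, so everything rests on Plancherel's theorem: the limit in mean exists and defines an
  isometric bijection of \<open>L\<^sup>2(\<real>\<^sup>d)\<close>.

  For \<open>f\<close> in \<open>L\<^sup>1 \<inter> L\<^sup>2\<close>, the squared modulus of the transform is the transform of the
  autocorrelation of \<open>f\<close>. Testing it against Gaussians of growing width and moving the transform
  onto the Gaussian gives the value of the autocorrelation at \<open>0\<close>, which is the squared norm of
  \<open>f\<close>; this uses that translation is continuous in \<open>L\<^sup>2\<close>. Completeness of \<open>L\<^sup>2\<close> extends the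
  isometry to all of \<open>L\<^sup>2\<close>, and surjectivity follows from the symmetry of the transform under
  the bilinear pairing \<open>\<integral> f g\<close>.
\<close>

subsection \<open>Square-integrable functions\<close>

text \<open>Both \<open>fourier\<close> and \<open>propagator\<close> are definite descriptions, so
  nothing can be said about their values before unique existence is proved. For
  \<open>propagator\<close> this means that a multiplied transform must again be a transform: an
  isometry alone would not do, and surjectivity is needed before any norms can be compared.

  The obstacle to Plancherel's identity is that the transform of an integrable function need not be
  integrable, so Fubini's theorem cannot be applied to its squared modulus directly. The Gaussian
  weight restores absolute convergence, and since the weights increase to 1, monotone convergence
  yields square-integrability of the transform together with its norm.

  A transform on L2 is determined only almost everywhere. The analysis is therefore done on
  functions, through the relation \<open>is_fourier\<close>, and the quotient \<open>l2\<close>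
  enters only at the end.\<close>

lemma square_integrable_measurable: "square_integrable f \<Longrightarrow> f \<in> borel_measurable borel"
  by (simp add: square_integrable_def)

lemma square_integrable_norm_integrable:
  "square_integrable f \<Longrightarrow> integrable lborel (\<lambda>x. (cmod (f x))\<^sup>2)"
  by (simp add: square_integrable_def)

lemma square_integrable_bound:
  assumes "square_integrable f" "g \<in> borel_measurable borel"
    and "\<And>x. cmod (g x) \<le> c * cmod (f x)"
  shows "square_integrable g"
proof -
  have "integrable lborel (\<lambda>x. c\<^sup>2 * (cmod (f x))\<^sup>2)"
    using assms(1) by (auto simp: square_integrable_def)
  moreover have "(cmod (g x))\<^sup>2 \<le> c\<^sup>2 * (cmod (f x))\<^sup>2" for x
    using power_mono[OF assms(3)[of x], of 2] by (simp add: power_mult_distrib)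
  ultimately have "integrable lborel (\<lambda>x. (cmod (g x))\<^sup>2)"
    using assms(2) by (elim Bochner_Integration.integrable_bound) auto
  then show ?thesis using assms(2) by (simp add: square_integrable_def)
qed

lemma sum_sq_le: "(a + b)\<^sup>2 \<le> 2 * a\<^sup>2 + 2 * (b::real)\<^sup>2"
  using sum_squares_bound[of a b] by (simp add: power2_sum)

lemma cmod_diff_sq_le: "(cmod (a - b))\<^sup>2 \<le> 2 * (cmod a)\<^sup>2 + 2 * (cmod b)\<^sup>2"
  by (rule order.trans[OF power_mono[OF norm_triangle_ineq4] sum_sq_le]) simp

lemma square_integrable_diff:
  assumes "square_integrable f" "square_integrable g"
  shows "square_integrable (\<lambda>x. f x - g x)"
proof -
  have m: "f \<in> borel_measurable borel" "g \<in> borel_measurable borel"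
    using assms by (auto simp: square_integrable_measurable)
  have "integrable lborel (\<lambda>x. 2 * (cmod (f x))\<^sup>2 + 2 * (cmod (g x))\<^sup>2)"
    using assms by (auto simp: square_integrable_def)
  then have "integrable lborel (\<lambda>x. (cmod (f x - g x))\<^sup>2)"
    by (rule Bochner_Integration.integrable_bound) (use m cmod_diff_sq_le in auto)
  then show ?thesis using m by (simp add: square_integrable_def)
qed

lemma borel_measurable_cnj [measurable (raw)]:
  assumes "f \<in> borel_measurable M"
  shows "(\<lambda>x. cnj (f x)) \<in> borel_measurable M"
  by (rule borel_measurable_continuous_on[OF _ assms]) (intro continuous_intros)

lemma square_integrable_cnj: "square_integrable f \<Longrightarrow> square_integrable (\<lambda>x. cnj (f x))"
  by (simp add: square_integrable_def borel_measurable_cnj)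

lemma square_integrable_nn_integral:
  "square_integrable f \<Longrightarrow>
    (\<integral>\<^sup>+x. ennreal ((cmod (f x))\<^sup>2) \<partial>lborel) = ennreal (\<integral>x. (cmod (f x))\<^sup>2 \<partial>lborel)"
  by (intro nn_integral_eq_integral) (auto simp: square_integrable_def)

section \<open>The bilinear pairing on L2 and its continuity\<close>

lemma square_integrable_mult_integrable:
  assumes "square_integrable f" "square_integrable g"
  shows "integrable lborel (\<lambda>x. f x * g x)"
proof -
  have m: "f \<in> borel_measurable borel" "g \<in> borel_measurable borel"
    using assms by (auto simp: square_integrable_measurable)
  have "integrable lborel (\<lambda>x. (cmod (f x))\<^sup>2 + (cmod (g x))\<^sup>2)"
    using assms by (auto simp: square_integrable_def)
  then show ?thesis
  proof (rule Bochner_Integration.integrable_bound)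
    show "AE x in lborel. norm (f x * g x) \<le> norm ((cmod (f x))\<^sup>2 + (cmod (g x))\<^sup>2)"
    proof (rule AE_I2)
      fix x
      have "2 * (cmod (f x) * cmod (g x)) \<le> (cmod (f x))\<^sup>2 + (cmod (g x))\<^sup>2"
        using sum_squares_bound[of "cmod (f x)" "cmod (g x)"] by simp
      moreover have "0 \<le> cmod (f x) * cmod (g x)" by simp
      ultimately have "cmod (f x) * cmod (g x) \<le> (cmod (f x))\<^sup>2 + (cmod (g x))\<^sup>2"
        by linarith
      then show "norm (f x * g x) \<le> norm ((cmod (f x))\<^sup>2 + (cmod (g x))\<^sup>2)"
        by (simp add: norm_mult)
    qed
  qed (use m in measurable)
qed

text \<open>The pairing carries no conjugate because this is the form under which the Fourier
  transform is symmetric; where an inner product is meant, \<open>cnj\<close> is inserted by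
  hand.\<close>

lemma l2_Cauchy_Schwarz:
  assumes "square_integrable f" "square_integrable g"
  shows "cmod (\<integral>x. f x * g x \<partial>lborel)
    \<le> sqrt (\<integral>x. (cmod (f x))\<^sup>2 \<partial>lborel) * sqrt (\<integral>x. (cmod (g x))\<^sup>2 \<partial>lborel)"
proof -
  have [measurable]: "f \<in> borel_measurable borel" "g \<in> borel_measurable borel"
    using assms by (auto simp: square_integrable_measurable)
  have fg: "integrable lborel (\<lambda>x. cmod (f x * g x))"
    using square_integrable_mult_integrable[OF assms] by simp
  have "(\<integral>\<^sup>+x. ennreal (cmod (f x)) * ennreal (cmod (g x)) \<partial>lborel)\<^sup>2
    \<le> (\<integral>\<^sup>+x. (ennreal (cmod (f x)))\<^sup>2 \<partial>lborel) * (\<integral>\<^sup>+x. (ennreal (cmod (g x)))\<^sup>2 \<partial>lborel)"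
    by (rule Cauchy_Schwarz_nn_integral) measurable
  also have "(\<integral>\<^sup>+x. ennreal (cmod (f x)) * ennreal (cmod (g x)) \<partial>lborel)
      = ennreal (\<integral>x. cmod (f x * g x) \<partial>lborel)"
    using nn_integral_eq_integral[OF fg] by (simp add: norm_mult ennreal_mult)
  finally have "ennreal ((\<integral>x. cmod (f x * g x) \<partial>lborel)\<^sup>2)
    \<le> ennreal ((\<integral>x. (cmod (f x))\<^sup>2 \<partial>lborel) * (\<integral>x. (cmod (g x))\<^sup>2 \<partial>lborel))"
    using assms by (simp add: ennreal_power square_integrable_nn_integral ennreal_mult)
  then have "(\<integral>x. cmod (f x * g x) \<partial>lborel)\<^sup>2
    \<le> (\<integral>x. (cmod (f x))\<^sup>2 \<partial>lborel) * (\<integral>x. (cmod (g x))\<^sup>2 \<partial>lborel)"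
    by (subst (asm) ennreal_le_iff) auto
  then have "(\<integral>x. cmod (f x * g x) \<partial>lborel)
    \<le> sqrt (\<integral>x. (cmod (f x))\<^sup>2 \<partial>lborel) * sqrt (\<integral>x. (cmod (g x))\<^sup>2 \<partial>lborel)"
    unfolding real_sqrt_mult[symmetric] by (rule real_le_rsqrt)
  then show ?thesis
    using integral_norm_bound[of lborel "\<lambda>x. f x * g x"] by linarith
qed

text \<open>With \<open>f' = f + a\<close> and \<open>g' = g + b\<close>, the error splits into the
  pairings of \<open>a\<close> with \<open>b\<close>, \<open>a\<close> with \<open>g\<close> and
  \<open>f\<close> with \<open>b\<close>, each controlled by Cauchy-Schwarz. The filter is left open
  because both sequences and radii tending to infinity occur.\<close>

lemma l2_tendsto_integral_mult:
  fixes f g :: "real ^ 'd \<Rightarrow> complex"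
  assumes sq: "\<And>n. square_integrable (f' n)" "\<And>n. square_integrable (g' n)"
      "square_integrable f" "square_integrable g"
    and f: "((\<lambda>n. \<integral>x. (cmod (f' n x - f x))\<^sup>2 \<partial>lborel) \<longlongrightarrow> 0) A"
    and g: "((\<lambda>n. \<integral>x. (cmod (g' n x - g x))\<^sup>2 \<partial>lborel) \<longlongrightarrow> 0) A"
  shows "((\<lambda>n. \<integral>x. f' n x * g' n x \<partial>lborel) \<longlongrightarrow> (\<integral>x. f x * g x \<partial>lborel)) A"
proof -
  let ?N = "\<lambda>h :: real ^ 'd \<Rightarrow> complex. sqrt (\<integral>x. (cmod (h x))\<^sup>2 \<partial>lborel)"
  let ?a = "\<lambda>n x. f' n x - f x" and ?b = "\<lambda>n x. g' n x - g x"
  have d: "square_integrable (?a n)" "square_integrable (?b n)" for n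
    using sq by (auto intro: square_integrable_diff)
  note int = square_integrable_mult_integrable[OF d(1) d(2)] square_integrable_mult_integrable[OF d(1) sq(4)]
    square_integrable_mult_integrable[OF sq(3) d(2)] square_integrable_mult_integrable[OF sq(3,4)]
  have eq: "(\<integral>x. f' n x * g' n x \<partial>lborel) - (\<integral>x. f x * g x \<partial>lborel)
      = (\<integral>x. ?a n x * ?b n x \<partial>lborel) + (\<integral>x. ?a n x * g x \<partial>lborel) + (\<integral>x. f x * ?b n x \<partial>lborel)" for n
  proof -
    have "(\<integral>x. f' n x * g' n x \<partial>lborel) =
       (\<integral>x. (?a n x * ?b n x + ?a n x * g x + f x * ?b n x) + f x * g x \<partial>lborel)"
      by (intro Bochner_Integration.integral_cong) (auto simp: algebra_simps)
    also have "\<dots> = (\<integral>x. ?a n x * ?b n x + ?a n x * g x + f x * ?b n x \<partial>lborel) + (\<integral>x. f x * g x \<partial>lborel)"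
      by (intro Bochner_Integration.integral_add Bochner_Integration.integrable_add int)
    also have "(\<integral>x. ?a n x * ?b n x + ?a n x * g x + f x * ?b n x \<partial>lborel)
        = (\<integral>x. ?a n x * ?b n x + ?a n x * g x \<partial>lborel) + (\<integral>x. f x * ?b n x \<partial>lborel)"
      by (intro Bochner_Integration.integral_add Bochner_Integration.integrable_add int)
    also have "(\<integral>x. ?a n x * ?b n x + ?a n x * g x \<partial>lborel)
        = (\<integral>x. ?a n x * ?b n x \<partial>lborel) + (\<integral>x. ?a n x * g x \<partial>lborel)"
      by (intro Bochner_Integration.integral_add int)
    finally show ?thesis by simp
  qed
  have le: "norm ((\<integral>x. f' n x * g' n x \<partial>lborel) - (\<integral>x. f x * g x \<partial>lborel))
    \<le> ?N (?a n) * ?N (?b n) + ?N (?a n) * ?N g + ?N f * ?N (?b n)" for n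
    unfolding eq
    by (intro norm_triangle_mono l2_Cauchy_Schwarz sq d)
  have f0: "((\<lambda>n. ?N (?a n)) \<longlongrightarrow> 0) A" and g0: "((\<lambda>n. ?N (?b n)) \<longlongrightarrow> 0) A"
    using tendsto_real_sqrt[OF f] tendsto_real_sqrt[OF g] by auto
  have "((\<lambda>n. ?N (?a n) * ?N (?b n) + ?N (?a n) * ?N g + ?N f * ?N (?b n)) \<longlongrightarrow> 0 * 0 + 0 * ?N g + ?N f * 0) A"
    by (intro tendsto_intros f0 g0)
  then have "((\<lambda>n. ?N (?a n) * ?N (?b n) + ?N (?a n) * ?N g + ?N f * ?N (?b n)) \<longlongrightarrow> 0) A"
    by (simp only: mult_zero_left mult_zero_right add_0_left)
  from Lim_null_comparison[OF always_eventually[OF allI[OF le]] this]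
  have "((\<lambda>n. (\<integral>x. f' n x * g' n x \<partial>lborel) - (\<integral>x. f x * g x \<partial>lborel)) \<longlongrightarrow> 0) A"
    .
  then show ?thesis by (rule LIM_zero_cancel)
qed

lemma l2_tendsto_norm:
  assumes sq: "\<And>n. square_integrable (f' n)" "square_integrable f"
    and f: "((\<lambda>n. \<integral>x. (cmod (f' n x - f x))\<^sup>2 \<partial>lborel) \<longlongrightarrow> 0) A"
  shows "((\<lambda>n. \<integral>x. (cmod (f' n x))\<^sup>2 \<partial>lborel) \<longlongrightarrow> (\<integral>x. (cmod (f x))\<^sup>2 \<partial>lborel)) A"
proof -
  have "((\<lambda>n. \<integral>x. (cmod (cnj (f' n x) - cnj (f x)))\<^sup>2 \<partial>lborel) \<longlongrightarrow> 0) A"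
    using f by (simp flip: complex_cnj_diff)
  from l2_tendsto_integral_mult[OF sq(1) square_integrable_cnj[OF sq(1)] sq(2) square_integrable_cnj[OF sq(2)] f this]
  have "((\<lambda>n. complex_of_real (\<integral>x. (cmod (f' n x))\<^sup>2 \<partial>lborel)) \<longlongrightarrow> complex_of_real (\<integral>x. (cmod (f x))\<^sup>2 \<partial>lborel)) A"
    by (simp flip: complex_norm_square del: of_real_power)
  then show ?thesis by (simp only: tendsto_of_real_iff)
qed

section \<open>Completeness of L2 along fast sequences\<close>

lemma geometric_increments_convergent:
  fixes a :: "nat \<Rightarrow> 'a::banach"
  assumes a: "\<And>n. norm (a (Suc n) - a n) \<le> c * r ^ n" and r: "0 \<le> r" "r < 1"
  shows "convergent a" and "norm (lim a - a n) \<le> c * r ^ n / (1 - r)"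
proof -
  have geo: "(\<lambda>k. c * r ^ n * r ^ k) sums (c * r ^ n * (1 / (1 - r)))" for n
    using r by (intro sums_mult geometric_sums) simp
  have "summable (\<lambda>k. a (Suc k) - a k)"
    by (rule summable_comparison_test'[OF sums_summable[OF geo[of 0]]]) (use a in auto)
  then have "(\<lambda>n. (\<Sum>k<n. a (Suc k) - a k) + a 0) \<longlonglongrightarrow> suminf (\<lambda>k. a (Suc k) - a k) + a 0"
    by (intro tendsto_intros summable_LIMSEQ)
  then show c: "convergent a"
    unfolding sum_lessThan_telescope convergent_def by auto
  have "(\<lambda>k. a (k + n)) \<longlonglongrightarrow> lim a"
    using c by (intro LIMSEQ_ignore_initial_segment) (simp add: convergent_LIMSEQ_iff)
  from telescope_sums[OF this] have "(\<lambda>k. a (Suc k + n) - a (k + n)) sums (lim a - a n)"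
    by simp
  from norm_sums_le[OF this geo[of n]] a[of "_ + n"]
  show "norm (lim a - a n) \<le> c * r ^ n / (1 - r)"
    by (simp add: power_add mult_ac)
qed

text \<open>The weight \<open>4 ^ n\<close> balances two demands: \<open>S\<close> is still
  integrable because \<open>(4/16) ^ n\<close> is summable, and where \<open>S\<close> is finite the
  increments of \<open>g\<close> are at most \<open>sqrt (S x) * (1/2) ^ n\<close>, so the pointwise
  limit exists. The resulting bound \<open>4 * (1/4) ^ n * S x\<close> on the squared error gives
  convergence in mean upon integration.\<close>

lemma l2_complete_fast:
  fixes g :: "nat \<Rightarrow> real ^ 'd \<Rightarrow> complex"
  assumes sq: "\<And>n. square_integrable (g n)"
    and fast: "\<And>n. (\<integral>x. (cmod (g (Suc n) x - g n x))\<^sup>2 \<partial>lborel) \<le> (1/16) ^ n"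
  obtains h where "square_integrable h" "(\<lambda>n. \<integral>x. (cmod (g n x - h x))\<^sup>2 \<partial>lborel) \<longlonglongrightarrow> 0"
proof -
  have [measurable]: "g n \<in> borel_measurable borel" for n
    using sq by (simp add: square_integrable_measurable)
  define D where "D n x = (cmod (g (Suc n) x - g n x))\<^sup>2" for n x
  define S where "S x = (\<Sum>n. ennreal (4 ^ n * D n x))" for x
  define h where "h x = lim (\<lambda>n. g n x)" for x
  have [measurable]: "D n \<in> borel_measurable borel" for n
    unfolding D_def by measurable
  have [measurable]: "h \<in> borel_measurable borel" "S \<in> borel_measurable borel"
    unfolding h_def S_def by measurable
  have sqd: "square_integrable (\<lambda>x. g (Suc n) x - g n x)" for n
    by (intro square_integrable_diff sq)
  have D: "(\<integral>\<^sup>+x. ennreal (4 ^ n * D n x) \<partial>lborel) \<le> ennreal ((1/4) ^ n)" for n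
  proof -
    have "(\<integral>\<^sup>+x. ennreal (4 ^ n * D n x) \<partial>lborel) = ennreal (4 ^ n) * (\<integral>\<^sup>+x. ennreal (D n x) \<partial>lborel)"
      by (subst nn_integral_cmult[symmetric]) (auto simp: D_def ennreal_mult)
    also have "\<dots> = ennreal (4 ^ n * (\<integral>x. D n x \<partial>lborel))"
      using square_integrable_nn_integral[OF sqd] by (simp add: D_def ennreal_mult)
    also have "4 ^ n * (\<integral>x. D n x \<partial>lborel) \<le> 4 ^ n * (1/16) ^ n"
      unfolding D_def by (intro mult_left_mono fast) auto
    also have "\<dots> = (1/4) ^ n"
      by (simp flip: power_mult_distrib)
    finally show ?thesis by (simp add: ennreal_leI)
  qed
  have "(\<integral>\<^sup>+x. S x \<partial>lborel) = (\<Sum>n. \<integral>\<^sup>+x. ennreal (4 ^ n * D n x) \<partial>lborel)"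
    unfolding S_def by (rule nn_integral_suminf) measurable
  also have "\<dots> \<le> (\<Sum>n. ennreal ((1/4) ^ n))"
    by (intro suminf_le D) auto
  also have "\<dots> < \<infinity>"
    using summable_geometric[of "1/4 :: real"]
    by (subst suminf_ennreal2) auto
  finally have Sfin: "(\<integral>\<^sup>+x. S x \<partial>lborel) < \<infinity>" .
  have bound: "ennreal ((cmod (g n x - h x))\<^sup>2) \<le> ennreal (4 * (1/4) ^ n) * S x" for n x
  proof (cases "S x = \<infinity>")
    \<comment> \<open>Here \<open>lim\<close> may be an unspecified value; the bound survives
      because its right-hand side is infinite.\<close>
    case True
    then show ?thesis by (simp add: ennreal_mult_top)
  next
    case False
    then obtain C where C: "S x = ennreal C" "0 \<le> C"
      by (cases "S x") auto
    have "cmod (g (Suc m) x - g m x) \<le> sqrt C * (1/2) ^ m" for m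
    proof -
      have "(\<Sum>n\<in>{m}. ennreal (4 ^ n * D n x)) \<le> S x"
        unfolding S_def by (rule sum_le_suminf) auto
      then have "4 ^ m * D m x \<le> C"
        using C by (simp add: ennreal_le_iff)
      then have "(2 ^ m * cmod (g (Suc m) x - g m x))\<^sup>2 \<le> C"
        by (simp add: D_def power_mult_distrib[of "2 ^ m"] power2_eq_square[of "2 ^ m"] flip: power_mult_distrib)
      from real_le_rsqrt[OF this] show ?thesis
        by (simp add: field_simps)
    qed
    from geometric_increments_convergent(2)[OF this, of n]
    have "cmod (h x - g n x) \<le> 2 * sqrt C * (1/2) ^ n"
      by (simp add: h_def)
    then have "(cmod (g n x - h x))\<^sup>2 \<le> (2 * sqrt C * (1/2) ^ n)\<^sup>2"
      by (intro power_mono) (auto simp: norm_minus_commute)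
    also have "\<dots> = 4 * ((1/2) ^ n * (1/2) ^ n) * C"
      using C(2) by (simp add: power_mult_distrib) (simp add: power2_eq_square)
    also have "\<dots> = 4 * (1/4) ^ n * C"
      by (simp flip: power_mult_distrib)
    finally show ?thesis
      using C by (simp add: ennreal_leI flip: ennreal_mult)
  qed
  define K where "K = enn2real (\<integral>\<^sup>+x. S x \<partial>lborel)"
  have K: "(\<integral>\<^sup>+x. S x \<partial>lborel) = ennreal K"
    using Sfin by (simp add: K_def)
  have K0: "0 \<le> K" by (simp add: K_def)
  have b: "(\<integral>\<^sup>+x. ennreal ((cmod (g n x - h x))\<^sup>2) \<partial>lborel) \<le> ennreal (4 * (1/4) ^ n * K)" for n
  proof -
    have "(\<integral>\<^sup>+x. ennreal ((cmod (g n x - h x))\<^sup>2) \<partial>lborel)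
        \<le> (\<integral>\<^sup>+x. ennreal (4 * (1/4) ^ n) * S x \<partial>lborel)"
      by (intro nn_integral_mono bound)
    also have "\<dots> = ennreal (4 * (1/4) ^ n * K)"
      by (subst nn_integral_cmult) (simp_all add: K K0 flip: ennreal_mult)
    finally show ?thesis .
  qed
  have sqh: "square_integrable (\<lambda>x. g n x - h x)" for n
    unfolding square_integrable_def
    using b[of n] by (auto intro!: integrableI_bounded simp: le_less_trans[OF _ ennreal_less_top])
  have "square_integrable h"
    using square_integrable_diff[OF sq[of 0] sqh[of 0]] by simp
  moreover have "(\<lambda>n. \<integral>x. (cmod (g n x - h x))\<^sup>2 \<partial>lborel) \<longlonglongrightarrow> 0"
  proof (rule tendsto_sandwich[OF _ _ tendsto_const])
    show "(\<lambda>n. 4 * (1/4) ^ n * K) \<longlonglongrightarrow> 0"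
      by (auto intro!: tendsto_eq_intros LIMSEQ_power_zero)
    show "\<forall>\<^sub>F n in sequentially. (\<integral>x. (cmod (g n x - h x))\<^sup>2 \<partial>lborel) \<le> 4 * (1/4) ^ n * K"
      using b by (simp add: square_integrable_nn_integral[OF sqh] ennreal_le_iff K0)
  qed simp
  ultimately show ?thesis by (rule that)
qed

subsection \<open>Continuity of translation\<close>

lemma lborel_integral_translation:
  fixes f :: "'a::euclidean_space \<Rightarrow> 'b::{banach, second_countable_topology}"
  assumes "f \<in> borel_measurable borel"
  shows "(\<integral>x. f (x + h) \<partial>lborel) = (\<integral>x. f x \<partial>lborel)"
  using integral_distr[of "(+) h" lborel borel f] assms
  by (simp add: lborel_distr_plus add.commute)

lemma lborel_integrable_translation:
  fixes f :: "'a::euclidean_space \<Rightarrow> 'b::{banach, second_countable_topology}"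
  assumes "integrable lborel f"
  shows "integrable lborel (\<lambda>x. f (x + h))"
  using integrable_distr[of "(+) h" lborel borel f] assms
  by (simp add: lborel_distr_plus add.commute)

lemma lborel_nn_integral_scaleR:
  fixes f :: "'a::euclidean_space \<Rightarrow> ennreal"
  assumes [measurable]: "f \<in> borel_measurable borel" and c: "c \<noteq> 0"
  shows "(\<integral>\<^sup>+x. f x \<partial>lborel) = \<bar>c\<bar> ^ DIM('a) * (\<integral>\<^sup>+x. f (c *\<^sub>R x) \<partial>lborel)"
  by (subst lborel_affine[OF c, of 0])
     (simp add: nn_integral_density nn_integral_distr nn_integral_cmult ennreal_power)

lemma lborel_integrable_scaleR:
  fixes f :: "'a::euclidean_space \<Rightarrow> 'b::{banach, second_countable_topology}"
  assumes f: "integrable lborel f" and c: "c \<noteq> 0"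
  shows "integrable lborel (\<lambda>x. f (c *\<^sub>R x))"
proof -
  have [measurable]: "f \<in> borel_measurable borel"
    using borel_measurable_integrable[OF f] by simp
  show ?thesis
    using f c lborel_nn_integral_scaleR[of "\<lambda>x. ennreal (norm (f x))" c]
    by (auto simp: integrable_iff_bounded ennreal_mult_less_top)
qed

lemma lborel_integral_scaleR:
  fixes f :: "'a::euclidean_space \<Rightarrow> 'b::{banach, second_countable_topology}"
  assumes [measurable]: "f \<in> borel_measurable borel" and c: "c \<noteq> 0"
  shows "(\<integral>x. f x \<partial>lborel) = \<bar>c\<bar> ^ DIM('a) *\<^sub>R (\<integral>x. f (c *\<^sub>R x) \<partial>lborel)"
  by (subst lborel_affine[OF c, of 0])
     (simp add: integral_density integral_distr)

text \<open>Three errors of \<open>e / 3\<close>: that of \<open>g\<close> under translation, that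
  of approximating \<open>f\<close> by \<open>g\<close>, and the translate of the latter, equal to
  it by invariance of the measure. The lemma makes the property stable under L1
  approximation.\<close>

lemma translation_tendsto_approx:
  fixes f :: "'a::euclidean_space \<Rightarrow> 'b::{banach, second_countable_topology}"
  assumes f: "integrable lborel f"
    and approx: "\<And>e. e > 0 \<Longrightarrow> \<exists>g. integrable lborel g \<and> (\<integral>x. norm (f x - g x) \<partial>lborel) \<le> e \<and>
      (\<lambda>n. \<integral>x. norm (g (x + X n) - g x) \<partial>lborel) \<longlonglongrightarrow> 0"
  shows "(\<lambda>n. \<integral>x. norm (f (x + X n) - f x) \<partial>lborel) \<longlonglongrightarrow> 0"
proof (rule order_tendstoI)
  fix e :: real assume e: "e > 0"
  obtain g where g: "integrable lborel g" "(\<integral>x. norm (f x - g x) \<partial>lborel) \<le> e / 3"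
      "(\<lambda>n. \<integral>x. norm (g (x + X n) - g x) \<partial>lborel) \<longlonglongrightarrow> 0"
    using approx[of "e/3"] e by auto
  note int = f g(1) lborel_integrable_translation[OF f] lborel_integrable_translation[OF g(1)]
  have [measurable]: "f \<in> borel_measurable borel" "g \<in> borel_measurable borel"
    using f g(1) borel_measurable_integrable by auto
  have bound: "(\<integral>x. norm (f (x + h) - f x) \<partial>lborel) \<le> (\<integral>x. norm (g (x + h) - g x) \<partial>lborel) + 2 * (e/3)" for h
  proof -
    have "(\<integral>x. norm (f (x + h) - f x) \<partial>lborel)
        \<le> (\<integral>x. norm (g (x + h) - g x) + norm (f (x + h) - g (x + h)) + norm (f x - g x) \<partial>lborel)"
    proof (rule integral_mono)
      fix x
      have "f (x + h) - f x = (g (x + h) - g x) + (f (x + h) - g (x + h)) + (g x - f x)"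
        by simp
      moreover have "norm (\<dots>)
          \<le> norm (g (x + h) - g x) + norm (f (x + h) - g (x + h)) + norm (g x - f x)"
        by (intro norm_triangle_mono order_refl)
      ultimately show "norm (f (x + h) - f x)
          \<le> norm (g (x + h) - g x) + norm (f (x + h) - g (x + h)) + norm (f x - g x)"
        by (simp add: norm_minus_commute)
    qed (use int in auto)
    also have "\<dots> = (\<integral>x. norm (g (x + h) - g x) \<partial>lborel) + (\<integral>x. norm (f (x + h) - g (x + h)) \<partial>lborel)
        + (\<integral>x. norm (f x - g x) \<partial>lborel)"
      using int by simp
    also have "(\<integral>x. norm (f (x + h) - g (x + h)) \<partial>lborel) = (\<integral>x. norm (f x - g x) \<partial>lborel)"
      by (rule lborel_integral_translation) measurable
    finally show ?thesis using g(2) by simp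
  qed
  have le: "(\<integral>x. norm (f (x + X n) - f x) \<partial>lborel) < e"
    if "(\<integral>x. norm (g (x + X n) - g x) \<partial>lborel) < e / 3" for n
    using that bound[of "X n"] by linarith
  have "\<forall>\<^sub>F n in sequentially. (\<integral>x. norm (g (x + X n) - g x) \<partial>lborel) < e / 3"
    using g(3) e by (intro order_tendstoD(2)) auto
  then show "\<forall>\<^sub>F n in sequentially. (\<integral>x. norm (f (x + X n) - f x) \<partial>lborel) < e"
    by eventually_elim (rule le)
next
  fix e :: real assume "e < 0"
  then have "e < (\<integral>x. norm (f (x + h) - f x) \<partial>lborel)" for h
    by (rule less_le_trans) simp
  then show "\<forall>\<^sub>F n in sequentially. e < (\<integral>x. norm (f (x + X n) - f x) \<partial>lborel)"
    by simp
qed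

text \<open>For an open set \<open>U\<close>, the overlap of \<open>U\<close> with its translates tends to \<open>U\<close> pointwise on
  all of \<open>U\<close>, with no regularity of the boundary.\<close>

lemma translation_tendsto_open:
  fixes U :: "'a::euclidean_space set"
  assumes U: "open U" "emeasure lborel U < \<infinity>" and X: "X \<longlonglongrightarrow> 0"
  shows "(\<lambda>n. \<integral>x. \<bar>indicator U (x + X n) - indicator U x\<bar> \<partial>lborel) \<longlonglongrightarrow> (0::real)"
proof -
  let ?I = "indicator U :: 'a \<Rightarrow> real"
  have [measurable]: "U \<in> sets borel" using U by simp
  have int: "integrable lborel ?I"
    using U by (simp add: integrable_indicator_iff)
  note inth = lborel_integrable_translation[OF int]
  have int2: "integrable lborel (\<lambda>x. ?I x * ?I (x + h))" for h
    using int by (rule Bochner_Integration.integrable_bound) (auto simp: indicator_def)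
  \<comment> \<open>On the values 0 and 1, \<open>|a - b| = a + b - 2 * a * b\<close>; by
    translation invariance only the overlap then depends on \<open>h\<close>.\<close>
  have eq: "(\<integral>x. \<bar>?I (x + h) - ?I x\<bar> \<partial>lborel) = 2 * (\<integral>x. ?I x \<partial>lborel) - 2 * (\<integral>x. ?I x * ?I (x + h) \<partial>lborel)" for h
  proof -
    have "(\<integral>x. \<bar>?I (x + h) - ?I x\<bar> \<partial>lborel) = (\<integral>x. ?I (x + h) + ?I x - 2 * (?I x * ?I (x + h)) \<partial>lborel)"
      by (intro Bochner_Integration.integral_cong) (auto simp: indicator_def)
    also have "\<dots> = (\<integral>x. ?I (x + h) \<partial>lborel) + (\<integral>x. ?I x \<partial>lborel) - 2 * (\<integral>x. ?I x * ?I (x + h) \<partial>lborel)"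
      using int inth int2
      by (simp only: Bochner_Integration.integral_diff Bochner_Integration.integral_add
          Bochner_Integration.integrable_add integrable_mult_right integral_mult_right_zero)
    also have "(\<integral>x. ?I (x + h) \<partial>lborel) = (\<integral>x. ?I x \<partial>lborel)"
      by (rule lborel_integral_translation) measurable
    finally show ?thesis by simp
  qed
  have "(\<lambda>n. \<integral>x. ?I x * ?I (x + X n) \<partial>lborel) \<longlonglongrightarrow> (\<integral>x. ?I x \<partial>lborel)"
  proof (rule integral_dominated_convergence[OF _ _ int])
    show "AE x in lborel. (\<lambda>n. ?I x * ?I (x + X n)) \<longlonglongrightarrow> ?I x"
    proof (rule AE_I2)
      fix x
      show "(\<lambda>n. ?I x * ?I (x + X n)) \<longlonglongrightarrow> ?I x"
      proof (cases "x \<in> U")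
        case True
        have "(\<lambda>n. x + X n) \<longlonglongrightarrow> x"
          using tendsto_add[OF tendsto_const X, of x] by simp
        from topological_tendstoD[OF this U(1) True]
        have "\<forall>\<^sub>F n in sequentially. ?I x * ?I (x + X n) = ?I x"
          by eventually_elim (use True in simp)
        then show ?thesis by (rule tendsto_eventually)
      qed simp
    qed
  qed (auto simp: indicator_def)
  from tendsto_diff[OF tendsto_const tendsto_mult_left[OF this], of "2 * (\<integral>x. ?I x \<partial>lborel)" 2]
  show ?thesis unfolding eq by simp
qed

text \<open>Sums follow from the triangle inequality and limits from approximation. For an
  indicator, outer regularity trades the measurable set for an open one, where the overlap argument
  works.\<close>

lemma translation_tendsto_L1:
  fixes f :: "'a::euclidean_space \<Rightarrow> 'b::{banach, second_countable_topology}"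
  assumes "integrable lborel f" and X: "X \<longlonglongrightarrow> 0"
  shows "(\<lambda>n. \<integral>x. norm (f (x + X n) - f x) \<partial>lborel) \<longlonglongrightarrow> 0"
  using assms(1)
proof induct
  case (base A c)
  then have [measurable]: "A \<in> sets borel" by simp
  have A: "integrable lborel (\<lambda>x. indicator A x *\<^sub>R c)"
    using base by (intro integrable_scaleR_left) (simp add: integrable_indicator_iff)
  then show ?case
  proof (rule translation_tendsto_approx)
    fix e :: real assume e: "e > 0"
    \<comment> \<open>The summand 1 keeps the denominator positive when \<open>c = 0\<close>; still
      \<open>d * norm c \<le> e\<close>.\<close>
    define d where "d = e / (norm c + 1)"
    have d: "d > 0" using e by (simp add: d_def add_nonneg_pos)
    obtain U where U: "open U" "A \<subseteq> U" "emeasure lborel (U - A) < d"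
      using outer_regular_lborel[of A d] d by auto
    have [measurable]: "U \<in> sets borel" using U by simp
    have "emeasure lborel U = emeasure lborel A + emeasure lborel (U - A)"
      using U(2) by (subst plus_emeasure) (auto simp: Un_absorb1)
    also have "\<dots> < \<infinity>"
      using base(2) U(3) by (auto simp: less_top dest: order.strict_trans[OF _ ennreal_less_top])
    finally have fin: "emeasure lborel U < \<infinity>" .
    have "(\<integral>x. norm (indicator A x *\<^sub>R c - indicator U x *\<^sub>R c) \<partial>lborel) = (\<integral>x. indicator (U - A) x * norm c \<partial>lborel)"
      using U(2) by (intro Bochner_Integration.integral_cong) (auto simp: indicator_def)
    also have "\<dots> = measure lborel (U - A) * norm c"
      by simp
    also have "\<dots> \<le> d * norm c"
      using U(3) d by (intro mult_right_mono) (auto simp: measure_def enn2real_leI)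
    also have "\<dots> \<le> e"
      using e by (simp add: d_def divide_le_eq add_nonneg_pos mult_left_mono)
    finally have "(\<integral>x. norm (indicator A x *\<^sub>R c - indicator U x *\<^sub>R c) \<partial>lborel) \<le> e" .
    moreover have "integrable lborel (\<lambda>x. indicator U x *\<^sub>R c)"
      using fin by (intro integrable_scaleR_left) (simp add: integrable_indicator_iff)
    moreover have "(\<lambda>n. \<integral>x. norm (indicator U (x + X n) *\<^sub>R c - indicator U x *\<^sub>R c) \<partial>lborel) \<longlonglongrightarrow> 0"
      using tendsto_mult_left_zero[OF translation_tendsto_open[OF U(1) fin X], of "norm c"]
      by (simp flip: scaleR_left_diff_distrib)
    ultimately show "\<exists>g. integrable lborel g \<and> (\<integral>x. norm (indicator A x *\<^sub>R c - g x) \<partial>lborel) \<le> e \<and>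
      (\<lambda>n. \<integral>x. norm (g (x + X n) - g x) \<partial>lborel) \<longlonglongrightarrow> 0"
      by blast
  qed
next
  case (add f g)
  note int = add(1,3) lborel_integrable_translation[OF add(1)] lborel_integrable_translation[OF add(3)]
  show ?case
  proof (rule tendsto_sandwich[OF _ _ tendsto_const])
    show "(\<lambda>n. (\<integral>x. norm (f (x + X n) - f x) \<partial>lborel) + (\<integral>x. norm (g (x + X n) - g x) \<partial>lborel)) \<longlonglongrightarrow> 0"
      using tendsto_add[OF add(2,4)] by simp
    have "(\<integral>x. norm (f (x + h) + g (x + h) - (f x + g x)) \<partial>lborel)
      \<le> (\<integral>x. norm (f (x + h) - f x) + norm (g (x + h) - g x) \<partial>lborel)" for h
      by (rule integral_mono) (use int in \<open>auto simp: norm_diff_triangle_ineq\<close>)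
    then show "\<forall>\<^sub>F n in sequentially. (\<integral>x. norm (f (x + X n) + g (x + X n) - (f x + g x)) \<partial>lborel)
      \<le> (\<integral>x. norm (f (x + X n) - f x) \<partial>lborel) + (\<integral>x. norm (g (x + X n) - g x) \<partial>lborel)"
      using int by simp
  qed simp
next
  case (lim f s)
  note [measurable] = borel_measurable_integrable[OF lim(1)] borel_measurable_integrable[OF lim(5)]
  have "(\<lambda>i. \<integral>x. norm (f x - s i x) \<partial>lborel) \<longlonglongrightarrow> (\<integral>x. norm (f x - f x) \<partial>lborel)"
  proof (rule integral_dominated_convergence)
    \<comment> \<open>The 3 comes from the bound \<open>norm (s i x) \<le> 2 * norm (f x)\<close>
      that the induction rule provides.\<close>
    show "integrable lborel (\<lambda>x. 3 * norm (f x))" using lim(5) by simp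
    show "AE x in lborel. (\<lambda>i. norm (f x - s i x)) \<longlonglongrightarrow> norm (f x - f x)"
      using lim(3) by (intro AE_I2 tendsto_intros) auto
    have "norm (norm (f x - s i x)) \<le> 3 * norm (f x)" for i x
      using norm_triangle_ineq4[of "f x" "s i x"] lim(4)[of x i] by simp
    then show "AE x in lborel. norm (norm (f x - s i x)) \<le> 3 * norm (f x)" for i
      by (intro AE_I2)
  qed measurable
  then have "(\<lambda>i. \<integral>x. norm (f x - s i x) \<partial>lborel) \<longlonglongrightarrow> 0" by simp
  note small = order_tendstoD(2)[OF this]
  from lim(5) show ?case
  proof (rule translation_tendsto_approx)
    fix e :: real assume "e > 0"
    from small[OF this] obtain i where "(\<integral>x. norm (f x - s i x) \<partial>lborel) < e"
      by (auto simp: eventually_sequentially)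
    with lim(1,2)[of i] show "\<exists>g. integrable lborel g \<and> (\<integral>x. norm (f x - g x) \<partial>lborel) \<le> e \<and>
      (\<lambda>n. \<integral>x. norm (g (x + X n) - g x) \<partial>lborel) \<longlonglongrightarrow> 0"
      by (intro exI[of _ "s i"]) auto
  qed
qed

text \<open>This carries continuity of translation from L1 to L2: for \<open>f\<close> in L2 the
  function \<open>cmod (f x) *\<^sub>R f x\<close> is integrable, and its L1 increments control the
  squared L2 increments of \<open>f\<close>. The reason is strong monotonicity of
  \<open>a \<mapsto> norm a *\<^sub>R a\<close>: its increment paired with \<open>a - b\<close> is
  at least half of \<open>norm (a - b) ^ 3\<close>, and Cauchy-Schwarz removes one factor.\<close>

lemma norm_diff_sq_le:
  fixes a b :: "'a::real_inner"
  shows "(norm (a - b))\<^sup>2 \<le> 2 * norm (norm a *\<^sub>R a - norm b *\<^sub>R b)"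
proof (cases "a = b")
  case False
  let ?A = "norm a" and ?B = "norm b" and ?d = "norm (a - b)"
  have d: "?d > 0" using False by simp
  have dd: "?d\<^sup>2 = ?A\<^sup>2 + ?B\<^sup>2 - 2 * (a \<bullet> b)"
    by (simp add: power2_norm_eq_inner inner_diff inner_commute)
  have "(norm a *\<^sub>R a - norm b *\<^sub>R b) \<bullet> (a - b) = ?A * (a \<bullet> a) + ?B * (b \<bullet> b) - (?A + ?B) * (a \<bullet> b)"
    by (simp add: inner_diff inner_commute algebra_simps)
  also have "\<dots> = (?A + ?B) * (?A\<^sup>2 + ?B\<^sup>2 - ?A * ?B - a \<bullet> b)"
    by (simp add: dot_square_norm algebra_simps power2_eq_square)
  also have "\<dots> = (?A + ?B) * ((?A - ?B)\<^sup>2 / 2 + ?d\<^sup>2 / 2)"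
    unfolding dd by (simp add: power2_eq_square field_simps)
  also have "\<dots> \<ge> (?A + ?B) * (?d\<^sup>2 / 2)"
    by (intro mult_left_mono) auto
  also have "(?A + ?B) * (?d\<^sup>2 / 2) \<ge> ?d * (?d\<^sup>2 / 2)"
    by (intro mult_right_mono norm_triangle_ineq4) auto
  finally have "?d * (?d\<^sup>2 / 2) \<le> (norm a *\<^sub>R a - norm b *\<^sub>R b) \<bullet> (a - b)" by simp
  also have "\<dots> \<le> norm (norm a *\<^sub>R a - norm b *\<^sub>R b) * ?d"
    by (rule norm_cauchy_schwarz)
  finally show ?thesis using d by simp
qed simp

lemma translation_tendsto_L2:
  fixes f :: "real ^ 'd \<Rightarrow> complex"
  assumes f: "square_integrable f" and X: "X \<longlonglongrightarrow> 0"
  shows "(\<lambda>n. \<integral>x. (cmod (f (x + X n) - f x))\<^sup>2 \<partial>lborel) \<longlonglongrightarrow> 0"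
proof -
  define g where "g x = cmod (f x) *\<^sub>R f x" for x
  have [measurable]: "f \<in> borel_measurable borel"
    using f by (rule square_integrable_measurable)
  have [measurable]: "g \<in> borel_measurable borel"
    unfolding g_def by measurable
  have g: "integrable lborel g"
    using square_integrable_norm_integrable[OF f]
    by (rule Bochner_Integration.integrable_bound) (auto simp: g_def power2_eq_square)
  have int: "integrable lborel (\<lambda>x. 2 * norm (g (x + h) - g x))" for h
    using g lborel_integrable_translation[OF g] by auto
  have "(\<integral>x. (cmod (f (x + h) - f x))\<^sup>2 \<partial>lborel) \<le> (\<integral>x. 2 * norm (g (x + h) - g x) \<partial>lborel)" for h
    by (rule integral_mono_AE'[OF int]) (use norm_diff_sq_le in \<open>auto simp: g_def\<close>)
  then have le: "(\<integral>x. (cmod (f (x + h) - f x))\<^sup>2 \<partial>lborel) \<le> 2 * (\<integral>x. norm (g (x + h) - g x) \<partial>lborel)" for h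
    by simp
  show ?thesis
  proof (rule tendsto_sandwich[OF _ _ tendsto_const])
    show "(\<lambda>n. 2 * (\<integral>x. norm (g (x + X n) - g x) \<partial>lborel)) \<longlonglongrightarrow> 0"
      using translation_tendsto_L1[OF g X] by (intro tendsto_mult_right_zero)
  qed (use le in auto)
qed

subsection \<open>The Gaussian\<close>

text \<open>\<open>lborel\<close> is the image of a product measure under the coordinate map; this
  reduces the Gaussian to one dimension.\<close>

lemma lborel_integral_prod:
  fixes f :: "'a::euclidean_space \<Rightarrow> real \<Rightarrow> complex"
  assumes f: "\<And>b. b \<in> Basis \<Longrightarrow> integrable lborel (f b)"
  shows "integrable lborel (\<lambda>x::'a. \<Prod>b\<in>Basis. f b (x \<bullet> b))"
    and "(\<integral>x. (\<Prod>b\<in>Basis. f b ((x::'a) \<bullet> b)) \<partial>lborel) = (\<Prod>b\<in>Basis. \<integral>x. f b x \<partial>lborel)"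
proof -
  interpret product_sigma_finite "\<lambda>_::'a. lborel :: real measure"
    by standard
  let ?T = "\<lambda>y::'a \<Rightarrow> real. \<Sum>b\<in>Basis. y b *\<^sub>R b"
  have [measurable]: "f b \<in> borel_measurable borel" if "b \<in> Basis" for b
    using borel_measurable_integrable[OF f[OF that]] by simp
  have m: "(\<lambda>x::'a. \<Prod>b\<in>Basis. f b (x \<bullet> b)) \<in> borel_measurable borel"
    by measurable
  have T: "?T \<in> (\<Pi>\<^sub>M b\<in>Basis. lborel) \<rightarrow>\<^sub>M borel"
    by measurable
  have eq: "(\<lambda>y. \<Prod>b\<in>Basis. f b (?T y \<bullet> b)) = (\<lambda>y. \<Prod>b\<in>Basis. f b (y b))"
    by (intro ext prod.cong refl) simp
  show "integrable lborel (\<lambda>x::'a. \<Prod>b\<in>Basis. f b (x \<bullet> b))"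
    unfolding lborel_eq[where 'a='a] integrable_distr_eq[OF T m] eq
    by (intro product_integrable_prod f) auto
  show "(\<integral>x. (\<Prod>b\<in>Basis. f b ((x::'a) \<bullet> b)) \<partial>lborel) = (\<Prod>b\<in>Basis. \<integral>x. f b x \<partial>lborel)"
    unfolding lborel_eq[where 'a='a] integral_distr[OF T m] eq
    by (intro product_integral_prod f) auto
qed

text \<open>Read off from the characteristic function of the standard normal distribution. The
  factor \<open>sqrt (2 * pi)\<close> undoes the normalisation of the density, and the argument is
  \<open>- t\<close> because \<open>char\<close> has the opposite sign in the exponent.\<close>

lemma gaussian_transform_real:
  fixes t :: real
  shows "integrable lborel (\<lambda>x. exp (- \<i> * of_real (x * t)) * of_real (exp (- x\<^sup>2 / 2)))"
    and "(\<integral>x. exp (- \<i> * of_real (x * t)) * of_real (exp (- x\<^sup>2 / 2)) \<partial>lborel)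
      = of_real (sqrt (2 * pi) * exp (- t\<^sup>2 / 2))"
proof -
  have eq: "exp (- \<i> * of_real (x * t)) * of_real (exp (- x\<^sup>2 / 2))
      = of_real (sqrt (2 * pi)) * (std_normal_density x *\<^sub>R iexp (- t * x))" for x
    by (simp add: std_normal_density_def scaleR_conv_of_real mult_ac)
  have "integrable lborel (\<lambda>x. std_normal_density x *\<^sub>R iexp (- t * x))"
    by (rule Bochner_Integration.integrable_bound[OF integrable_normal_density[of 1 0]]) auto
  then show "integrable lborel (\<lambda>x. exp (- \<i> * of_real (x * t)) * of_real (exp (- x\<^sup>2 / 2)))"
    unfolding eq by (rule integrable_mult_right)
  have "(\<integral>x. std_normal_density x *\<^sub>R iexp (- t * x) \<partial>lborel) = char std_normal_distribution (- t)"
    unfolding char_def by (subst integral_density) auto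
  then show "(\<integral>x. exp (- \<i> * of_real (x * t)) * of_real (exp (- x\<^sup>2 / 2)) \<partial>lborel)
      = of_real (sqrt (2 * pi) * exp (- t\<^sup>2 / 2))"
    unfolding eq integral_mult_right_zero by (simp add: char_std_normal_distribution)
qed

lemma gaussian_transform:
  fixes w :: "'a::euclidean_space"
  shows "integrable lborel (\<lambda>x::'a. exp (- \<i> * of_real (x \<bullet> w)) * of_real (exp (- (norm x)\<^sup>2 / 2)))"
    and "(\<integral>x. exp (- \<i> * of_real (x \<bullet> w)) * of_real (exp (- (norm x)\<^sup>2 / 2)) \<partial>lborel)
      = of_real (sqrt (2 * pi) ^ DIM('a) * exp (- (norm w)\<^sup>2 / 2))"
proof -
  let ?f = "\<lambda>b x. exp (- \<i> * of_real (x * (w \<bullet> b))) * complex_of_real (exp (- x\<^sup>2 / 2))"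
  have norm_sum: "(norm x)\<^sup>2 = (\<Sum>b\<in>Basis. (x \<bullet> b)\<^sup>2)" for x :: 'a
    unfolding power2_norm_eq_inner by (subst euclidean_inner) (simp add: power2_eq_square)
  have eq: "exp (- \<i> * of_real (x \<bullet> w)) * of_real (exp (- (norm x)\<^sup>2 / 2)) = (\<Prod>b\<in>Basis. ?f b (x \<bullet> b))" for x
  proof -
    have "exp (- \<i> * of_real (x \<bullet> w)) = (\<Prod>b\<in>Basis. exp (- \<i> * of_real ((x \<bullet> b) * (w \<bullet> b))))"
      by (subst euclidean_inner) (simp add: sum_distrib_left exp_sum flip: sum_negf)
    moreover have "exp (- (norm x)\<^sup>2 / 2) = (\<Prod>b\<in>Basis. exp (- (x \<bullet> b)\<^sup>2 / 2))"
      unfolding norm_sum by (simp add: sum_divide_distrib exp_sum flip: sum_negf)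
    ultimately show ?thesis by (simp add: prod.distrib)
  qed
  note f = gaussian_transform_real
  show "integrable lborel (\<lambda>x::'a. exp (- \<i> * of_real (x \<bullet> w)) * of_real (exp (- (norm x)\<^sup>2 / 2)))"
    unfolding eq by (rule lborel_integral_prod(1)[of ?f, OF f(1)])
  have "(\<integral>x. exp (- \<i> * of_real (x \<bullet> w)) * of_real (exp (- (norm x)\<^sup>2 / 2)) \<partial>lborel)
      = (\<Prod>b\<in>Basis. complex_of_real (sqrt (2 * pi) * exp (- (w \<bullet> b)\<^sup>2 / 2)))"
    unfolding eq by (subst lborel_integral_prod(2)[of ?f, OF f(1)]) (simp only: f(2))
  also have "\<dots> = of_real (sqrt (2 * pi) ^ DIM('a) * exp (- (norm w)\<^sup>2 / 2))"
    unfolding norm_sum by (simp add: sum_divide_distrib exp_sum prod.distrib flip: sum_negf)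
  finally show "(\<integral>x. exp (- \<i> * of_real (x \<bullet> w)) * of_real (exp (- (norm x)\<^sup>2 / 2)) \<partial>lborel)
      = of_real (sqrt (2 * pi) ^ DIM('a) * exp (- (norm w)\<^sup>2 / 2))" .
qed

subsection \<open>The Fourier integral of integrable functions\<close>

lemma fourier_integral_measurable [measurable]:
  assumes [measurable]: "f \<in> borel_measurable borel"
  shows "fourier_integral f \<in> borel_measurable borel"
proof -
  have "(\<lambda>\<zeta>. \<integral>x. exp (- \<i> * of_real (x \<bullet> \<zeta>)) * f x \<partial>lborel) \<in> borel_measurable borel"
    by measurable
  then show ?thesis unfolding fourier_integral_def[abs_def] by measurable
qed

lemma integrable_exp_mult:
  fixes f :: "real ^ 'd \<Rightarrow> complex"
  assumes "integrable lborel f"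
  shows "integrable lborel (\<lambda>x. exp (- \<i> * of_real (x \<bullet> \<zeta>)) * f x)"
  using assms
  by (rule Bochner_Integration.integrable_bound)
     (use borel_measurable_integrable[OF assms] in \<open>auto simp: norm_mult\<close>)

lemma fourier_integral_diff:
  assumes "integrable lborel f" "integrable lborel g"
  shows "fourier_integral (\<lambda>x. f x - g x) \<zeta> = fourier_integral f \<zeta> - fourier_integral g \<zeta>"
  unfolding fourier_integral_def
  using integrable_exp_mult[OF assms(1)] integrable_exp_mult[OF assms(2)]
  by (simp add: right_diff_distrib)

lemma integrable_lborel_tensor:
  fixes f :: "'a::euclidean_space \<Rightarrow> complex" and g :: "'b::euclidean_space \<Rightarrow> complex"
  assumes f: "integrable lborel f" and g: "integrable lborel g"
  shows "integrable (lborel \<Otimes>\<^sub>M lborel) (\<lambda>(x, y). f x * g y)"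
proof (rule lborel_pair.Fubini_integrable)
  have [measurable]: "f \<in> borel_measurable borel" "g \<in> borel_measurable borel"
    using borel_measurable_integrable[OF f] borel_measurable_integrable[OF g] by auto
  show "(\<lambda>(x, y). f x * g y) \<in> borel_measurable (lborel \<Otimes>\<^sub>M lborel)"
    by measurable
  show "integrable lborel (\<lambda>x. \<integral>y. norm (case (x, y) of (x, y) \<Rightarrow> f x * g y) \<partial>lborel)"
    using f by (simp add: norm_mult)
  show "AE x in lborel. integrable lborel (\<lambda>y. case (x, y) of (x, y) \<Rightarrow> f x * g y)"
    using g by simp
qed

text \<open>The kernel has modulus one and is symmetric in \<open>x\<close> and
  \<open>\<zeta>\<close>. Integrability of both functions makes the double integral absolutely
  convergent, so Fubini's theorem applies.\<close>

lemma fourier_integral_adjoint: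
  fixes f g :: "real ^ 'd \<Rightarrow> complex"
  assumes f: "integrable lborel f" and g: "integrable lborel g"
  shows "(\<integral>\<zeta>. fourier_integral f \<zeta> * g \<zeta> \<partial>lborel) = (\<integral>x. f x * fourier_integral g x \<partial>lborel)"
proof -
  have [measurable]: "f \<in> borel_measurable borel" "g \<in> borel_measurable borel"
    using borel_measurable_integrable[OF f] borel_measurable_integrable[OF g] by auto
  let ?c = "complex_of_real ((2 * pi) powr (- real CARD('d) / 2))"
  let ?K = "\<lambda>x \<zeta>. ?c * exp (- \<i> * of_real (x \<bullet> \<zeta>)) * (f x * g \<zeta>)"
  have "integrable (lborel \<Otimes>\<^sub>M lborel) (\<lambda>(x, \<zeta>). ?c * (f x * g \<zeta>))"
    using integrable_mult_right[OF integrable_lborel_tensor[OF f g], of ?c]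
    by (simp add: case_prod_unfold)
  then have "integrable (lborel \<Otimes>\<^sub>M lborel) (\<lambda>(x, \<zeta>). ?K x \<zeta>)"
    by (rule Bochner_Integration.integrable_bound) (auto simp: norm_mult)
  from lborel_pair.Fubini_integral[OF this]
  have "(\<integral>\<zeta>. \<integral>x. ?K x \<zeta> \<partial>lborel \<partial>lborel) = (\<integral>x. \<integral>\<zeta>. ?K x \<zeta> \<partial>lborel \<partial>lborel)" .
  moreover have "(\<integral>x. ?K x \<zeta> \<partial>lborel) = fourier_integral f \<zeta> * g \<zeta>" for \<zeta>
  proof -
    have K: "?K x \<zeta> = ?c * (exp (- \<i> * of_real (x \<bullet> \<zeta>)) * f x) * g \<zeta>" for x by (simp add: mult_ac)
    show ?thesis unfolding fourier_integral_def K by simp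
  qed
  moreover have "(\<integral>\<zeta>. ?K x \<zeta> \<partial>lborel) = f x * fourier_integral g x" for x
  proof -
    have K: "?K x \<zeta> = f x * (?c * (exp (- \<i> * of_real (\<zeta> \<bullet> x)) * g \<zeta>))" for \<zeta>
      by (simp add: mult_ac inner_commute)
    show ?thesis unfolding fourier_integral_def K by simp
  qed
  ultimately show ?thesis by simp
qed

subsection \<open>The autocorrelation\<close>

text \<open>The convolution of \<open>f\<close> with \<open>\<lambda>x. cnj (f (- x))\<close>. For
  \<open>f\<close> merely integrable, convergence is guaranteed only for almost every
  \<open>w\<close>, and the integral defaults to 0 where it fails; for \<open>f\<close> in L2 it
  converges for all \<open>w\<close>.\<close>

definition autocorrelation :: "(real ^ 'd \<Rightarrow> complex) \<Rightarrow> real ^ 'd \<Rightarrow> complex" where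
  "autocorrelation f w = (\<integral>x. f (x + w) * cnj (f x) \<partial>lborel)"

lemma autocorrelation_measurable [measurable]:
  assumes [measurable]: "f \<in> borel_measurable borel"
  shows "autocorrelation f \<in> borel_measurable borel"
  unfolding autocorrelation_def[abs_def] by measurable

lemma integrable_translation_pair:
  fixes f :: "real ^ 'd \<Rightarrow> complex"
  assumes f: "integrable lborel f"
  shows "integrable (lborel \<Otimes>\<^sub>M lborel) (\<lambda>(x, w). f (x + w) * cnj (f x))"
proof (rule lborel_pair.Fubini_integrable)
  have [measurable]: "f \<in> borel_measurable borel"
    using borel_measurable_integrable[OF f] by simp
  show "(\<lambda>(x, w). f (x + w) * cnj (f x)) \<in> borel_measurable (lborel \<Otimes>\<^sub>M lborel)"
    by measurable
  have tr: "(\<integral>w. cmod (f (x + w)) \<partial>lborel) = (\<integral>w. cmod (f w) \<partial>lborel)" for x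
    using lborel_integral_translation[of "\<lambda>w. cmod (f w)" x] by (simp add: add.commute)
  show "integrable lborel (\<lambda>x. \<integral>w. norm (case (x, w) of (x, w) \<Rightarrow> f (x + w) * cnj (f x)) \<partial>lborel)"
    using f by (simp add: norm_mult tr)
  show "AE x in lborel. integrable lborel (\<lambda>w. case (x, w) of (x, w) \<Rightarrow> f (x + w) * cnj (f x))"
    using lborel_integrable_translation[OF f] by (simp add: add.commute)
qed

lemma autocorrelation_integrable:
  assumes f: "integrable lborel f"
  shows "integrable lborel (autocorrelation f)"
  using lborel_pair.integrable_snd[OF integrable_translation_pair[OF f]]
  by (simp add: autocorrelation_def[abs_def])

text \<open>The left-hand side contains the square of the normalising factor and
  \<open>fourier_integral\<close> on the right supplies one, which leaves a single
  \<open>c\<close>.\<close>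

lemma autocorrelation_transform:
  fixes f :: "real ^ 'd \<Rightarrow> complex"
  assumes f: "integrable lborel f"
  defines "c \<equiv> (2 * pi) powr (- real CARD('d) / 2)"
  shows "of_real ((cmod (fourier_integral f \<zeta>))\<^sup>2)
    = of_real c * fourier_integral (autocorrelation f) \<zeta>"
proof -
  have [measurable]: "f \<in> borel_measurable borel"
    using borel_measurable_integrable[OF f] by simp
  define e where "e x = exp (- \<i> * complex_of_real (x \<bullet> \<zeta>))" for x
  have e_add: "e (x + w) = e x * e w" and e_norm: "cmod (e x) = 1" and e_cnj: "e x * cnj (e x) = 1" for x w
  proof -
    show "e (x + w) = e x * e w"
      by (simp add: e_def inner_add_left exp_add[symmetric] algebra_simps)
    show "cmod (e x) = 1" by (simp add: e_def)
    then show "e x * cnj (e x) = 1" by (simp add: complex_norm_square[symmetric])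
  qed
  have [measurable]: "e \<in> borel_measurable borel" unfolding e_def by measurable
  let ?F = "\<integral>x. e x * f x \<partial>lborel"
  have "integrable (lborel \<Otimes>\<^sub>M lborel) (\<lambda>(x, w). e w * (f (x + w) * cnj (f x)))"
    using integrable_translation_pair[OF f]
    by (rule Bochner_Integration.integrable_bound) (auto simp: norm_mult e_norm)
  from lborel_pair.Fubini_integral[OF this]
  have "(\<integral>w. \<integral>x. e w * (f (x + w) * cnj (f x)) \<partial>lborel \<partial>lborel)
      = (\<integral>x. \<integral>w. e w * (f (x + w) * cnj (f x)) \<partial>lborel \<partial>lborel)" .
  also have "\<dots> = (\<integral>x. ?F * cnj (e x * f x) \<partial>lborel)"
  proof (rule Bochner_Integration.integral_cong[OF refl])
    fix x
    \<comment> \<open>The phase \<open>e w\<close> equals \<open>e (w + x) * cnj (e x)\<close>,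
      which makes the inner integral a translate of \<open>?F\<close> and hence independent of
      \<open>x\<close>.\<close>
    have "e w * (f (x + w) * cnj (f x)) = e (w + x) * f (w + x) * cnj (e x * f x)" for w
    proof -
      have "e (w + x) * f (w + x) * cnj (e x * f x) = e w * (e x * cnj (e x)) * (f (x + w) * cnj (f x))"
        by (simp add: e_add add.commute mult_ac)
      then show ?thesis by (simp only: e_cnj mult_1_right)
    qed
    then have "(\<integral>w. e w * (f (x + w) * cnj (f x)) \<partial>lborel)
        = (\<integral>w. e (w + x) * f (w + x) \<partial>lborel) * cnj (e x * f x)"
      by (simp only: integral_mult_left_zero)
    also have "(\<integral>w. e (w + x) * f (w + x) \<partial>lborel) = ?F"
      by (rule lborel_integral_translation[of "\<lambda>w. e w * f w"]) measurable
    finally show "(\<integral>w. e w * (f (x + w) * cnj (f x)) \<partial>lborel) = ?F * cnj (e x * f x)" .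
  qed
  also have "\<dots> = ?F * cnj ?F"
    by (simp only: integral_mult_right_zero Bochner_Integration.integral_cnj)
  finally have F: "(\<integral>w. e w * autocorrelation f w \<partial>lborel) = ?F * cnj ?F"
    by (simp add: autocorrelation_def)
  have "fourier_integral f \<zeta> = of_real c * ?F"
    by (simp only: fourier_integral_def e_def c_def)
  moreover have "fourier_integral (autocorrelation f) \<zeta> = of_real c * (?F * cnj ?F)"
    unfolding F[symmetric] by (simp only: fourier_integral_def e_def c_def)
  ultimately show ?thesis
    by (simp only: complex_norm_square complex_cnj_mult complex_cnj_complex_of_real mult_ac)
qed

lemma autocorrelation_0:
  "autocorrelation f 0 = of_real (\<integral>x. (cmod (f x))\<^sup>2 \<partial>lborel)"
  by (simp add: autocorrelation_def complex_norm_square[symmetric] del: of_real_power)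

lemma square_integrable_translation:
  assumes f: "square_integrable f"
  shows "square_integrable (\<lambda>x. f (x + h))"
proof -
  have [measurable]: "f \<in> borel_measurable borel"
    using f by (rule square_integrable_measurable)
  show ?thesis
    using lborel_integrable_translation[OF square_integrable_norm_integrable[OF f], of h]
    by (simp add: square_integrable_def)
qed

text \<open>Cauchy-Schwarz for \<open>f\<close> and its translate, which have the same norm. The
  bound is the dominating constant in \<open>plancherel_L1_L2\<close>.\<close>

lemma norm_autocorrelation_le:
  assumes f: "square_integrable f"
  shows "cmod (autocorrelation f w) \<le> (\<integral>x. (cmod (f x))\<^sup>2 \<partial>lborel)"
proof -
  have [measurable]: "f \<in> borel_measurable borel"
    using f by (rule square_integrable_measurable)
  have "(\<integral>x. (cmod (f (x + w)))\<^sup>2 \<partial>lborel) = (\<integral>x. (cmod (f x))\<^sup>2 \<partial>lborel)"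
    by (rule lborel_integral_translation) measurable
  with l2_Cauchy_Schwarz[OF square_integrable_translation[OF f] square_integrable_cnj[OF f], of w]
  show ?thesis by (simp add: autocorrelation_def flip: real_sqrt_mult)
qed

text \<open>Translates of \<open>f\<close> converge to \<open>f\<close> in mean, so their pairings
  with \<open>cnj f\<close> converge. Continuity at 0 suffices because the transformed Gaussians
  concentrate there.\<close>

lemma autocorrelation_continuous_0:
  assumes f: "square_integrable f" and X: "X \<longlonglongrightarrow> 0"
  shows "(\<lambda>n. autocorrelation f (X n)) \<longlonglongrightarrow> of_real (\<integral>x. (cmod (f x))\<^sup>2 \<partial>lborel)"
  unfolding autocorrelation_0[symmetric] unfolding autocorrelation_def
  by (rule l2_tendsto_integral_mult)
     (use translation_tendsto_L2[OF assms] square_integrable_translation[OF f] square_integrable_cnj[OF f] f in auto)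

subsection \<open>Plancherel's identity on \<open>L\<^sup>1 \<inter> L\<^sup>2\<close>\<close>

text \<open>The unitary factor cancels the mass of the Gaussian in dimension \<open>n\<close>, so
  the standard Gaussian is its own transform.\<close>

lemma powr_two_pi_half: "(2 * pi) powr (- real n / 2) * sqrt (2 * pi) ^ n = 1"
proof -
  have "sqrt (2 * pi) ^ n = (2 * pi) powr (real n / 2)"
    by (simp add: powr_half_sqrt[symmetric] powr_powr flip: powr_realpow)
  then show ?thesis by (simp flip: powr_add)
qed

text \<open>For positive \<open>s\<close>, smaller values give wider Gaussians, increasing to 1 as
  \<open>s\<close> tends to 0. The parameter sits inside the norm so that dilations of the variable
  act on it directly.\<close>

definition gaussian :: "real \<Rightarrow> real ^ 'd \<Rightarrow> complex" where
  "gaussian s x = of_real (exp (- (norm (s *\<^sub>R x))\<^sup>2 / 2))"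

lemma gaussian_integrable:
  assumes "s \<noteq> 0"
  shows "integrable lborel (gaussian s :: real ^ 'd \<Rightarrow> complex)"
  using lborel_integrable_scaleR[OF gaussian_transform(1)[of "0 :: real ^ 'd"] assms]
  by (simp add: gaussian_def[abs_def])

text \<open>A dilation by \<open>inverse s\<close> reduces this to the self-dual case
  \<open>s = 1\<close>. A wide Gaussian becomes a narrow peak whose mass does not depend on
  \<open>s\<close>.\<close>

lemma fourier_integral_gaussian:
  assumes s: "s > 0"
  shows "fourier_integral (gaussian s :: real ^ 'd \<Rightarrow> complex) w
    = of_real (inverse s ^ CARD('d)) * gaussian (inverse s) w"
proof -
  let ?g = "\<lambda>x :: real ^ 'd. exp (- \<i> * of_real (x \<bullet> w)) * gaussian s x"
  let ?C = "complex_of_real ((2 * pi) powr (- real CARD('d) / 2))"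
  have "?g \<in> borel_measurable borel" unfolding gaussian_def by measurable
  from lborel_integral_scaleR[OF this, of "inverse s"] s
  have "(\<integral>x. ?g x \<partial>lborel) = of_real (inverse s ^ CARD('d)) *
      (\<integral>x. exp (- \<i> * of_real ((x :: real ^ 'd) \<bullet> (inverse s *\<^sub>R w))) * of_real (exp (- (norm x)\<^sup>2 / 2)) \<partial>lborel)"
    by (simp add: gaussian_def scaleR_conv_of_real[where 'a=complex])
  also have "\<dots> = of_real (inverse s ^ CARD('d)) * (of_real (sqrt (2 * pi) ^ CARD('d)) * gaussian (inverse s) w)"
    unfolding gaussian_transform(2) by (simp add: gaussian_def)
  finally have "fourier_integral (gaussian s) w
      = of_real (inverse s ^ CARD('d)) * (?C * of_real (sqrt (2 * pi) ^ CARD('d))) * gaussian (inverse s) w"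
    by (simp add: fourier_integral_def mult_ac)
  also have "?C * of_real (sqrt (2 * pi) ^ CARD('d)) = 1"
    using powr_two_pi_half[of "CARD('d)"] by (simp only: of_real_mult[symmetric] of_real_1)
  finally show ?thesis by simp
qed

text \<open>The Gaussian weight makes the integral of the squared modulus of the transform absolutely
  convergent; moving the transform onto the Gaussian turns it into an average of the
  autocorrelation against an approximate identity.\<close>

lemma plancherel_gaussian_regularised:
  fixes f :: "real ^ 'd \<Rightarrow> complex"
  assumes f: "integrable lborel f" and s: "s > 0"
  defines "c \<equiv> (2 * pi) powr (- real CARD('d) / 2)"
  shows "(\<integral>\<zeta>. of_real ((cmod (fourier_integral f \<zeta>))\<^sup>2) * gaussian s \<zeta> \<partial>lborel)
    = of_real c * (\<integral>z. autocorrelation f (s *\<^sub>R z) * gaussian 1 z \<partial>lborel)"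
proof -
  have [measurable]: "f \<in> borel_measurable borel"
    using borel_measurable_integrable[OF f] by simp
  have "(\<integral>\<zeta>. of_real ((cmod (fourier_integral f \<zeta>))\<^sup>2) * gaussian s \<zeta> \<partial>lborel)
      = (\<integral>\<zeta>. of_real c * (fourier_integral (autocorrelation f) \<zeta> * gaussian s \<zeta>) \<partial>lborel)"
    unfolding autocorrelation_transform[OF f] c_def by (simp add: mult_ac)
  also have "\<dots> = of_real c * (\<integral>w. autocorrelation f w * fourier_integral (gaussian s) w \<partial>lborel)"
    using s by (simp add: fourier_integral_adjoint autocorrelation_integrable f gaussian_integrable)
  also have "(\<integral>w. autocorrelation f w * fourier_integral (gaussian s) w \<partial>lborel)
      = of_real (inverse s ^ CARD('d)) * (\<integral>w. autocorrelation f w * gaussian (inverse s) w \<partial>lborel)"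
    unfolding fourier_integral_gaussian[OF s] integral_mult_right_zero[symmetric]
    by (simp only: mult.left_commute)
  \<comment> \<open>With \<open>w = s *\<^sub>R z\<close> the powers of \<open>s\<close> cancel, and
    \<open>s\<close> moves from the weight into the argument of the autocorrelation, so that one
    fixed Gaussian dominates for all \<open>s\<close>.\<close>
  also have "(\<integral>w. autocorrelation f w * gaussian (inverse s) w \<partial>lborel)
      = of_real (s ^ CARD('d)) * (\<integral>z. autocorrelation f (s *\<^sub>R z) * gaussian 1 z \<partial>lborel)"
  proof -
    have "(\<lambda>w. autocorrelation f w * gaussian (inverse s) w) \<in> borel_measurable borel"
      unfolding gaussian_def by measurable
    from lborel_integral_scaleR[OF this, of s] s show ?thesis
      by (simp add: gaussian_def scaleR_conv_of_real[where 'a=complex])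
  qed
  finally show ?thesis
    using s by (simp add: field_simps)
qed

text \<open>The same integrals are passed to the limit in two ways. On the side of the
  autocorrelation, dominated convergence gives \<open>N\<close>; on the side of the transform,
  \<open>G n\<close> increases to the squared modulus, and monotone convergence gives integrability
  along with the value.\<close>

theorem plancherel_L1_L2:
  fixes f :: "real ^ 'd \<Rightarrow> complex"
  assumes f: "integrable lborel f" and f2: "square_integrable f"
  shows "square_integrable (fourier_integral f)"
    and "(\<integral>\<zeta>. (cmod (fourier_integral f \<zeta>))\<^sup>2 \<partial>lborel) = (\<integral>x. (cmod (f x))\<^sup>2 \<partial>lborel)"
proof -
  have [measurable]: "f \<in> borel_measurable borel"
    using f2 by (rule square_integrable_measurable)
  define c where "c = (2 * pi) powr (- real CARD('d) / 2)"
  define s where "s n = inverse (real (Suc n))" for n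
  define N where "N = (\<integral>x. (cmod (f x))\<^sup>2 \<partial>lborel)"
  have N0: "0 \<le> N" by (simp add: N_def)
  have s: "s n > 0" for n by (simp add: s_def)
  have s0: "s \<longlonglongrightarrow> 0" unfolding s_def by (rule LIMSEQ_inverse_real_of_nat)
  have meas_g [measurable]: "gaussian t \<in> borel_measurable borel" for t
    unfolding gaussian_def[abs_def] by measurable
  define G where "G n \<zeta> = (cmod (fourier_integral f \<zeta>))\<^sup>2 * exp (- (norm (s n *\<^sub>R \<zeta>))\<^sup>2 / 2)" for n \<zeta>
  have G_of_real: "of_real ((cmod (fourier_integral f \<zeta>))\<^sup>2) * gaussian (s n) \<zeta> = of_real (G n \<zeta>)" for n \<zeta>
    by (simp add: G_def gaussian_def)
  have "(\<lambda>n. \<integral>z. autocorrelation f (s n *\<^sub>R z) * gaussian 1 z \<partial>lborel)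
      \<longlonglongrightarrow> (\<integral>z. of_real N * gaussian 1 (z :: real ^ 'd) \<partial>lborel)"
  proof (rule integral_dominated_convergence)
    show "integrable lborel (\<lambda>z :: real ^ 'd. N * cmod (gaussian 1 z))"
      by (intro integrable_mult_right integrable_norm gaussian_integrable) simp
    show "AE z in lborel. (\<lambda>n. autocorrelation f (s n *\<^sub>R z) * gaussian 1 z) \<longlonglongrightarrow> of_real N * gaussian 1 z"
    proof (intro AE_I2 tendsto_mult_right)
      fix z :: "real ^ 'd"
      show "(\<lambda>n. autocorrelation f (s n *\<^sub>R z)) \<longlonglongrightarrow> of_real N"
        unfolding N_def using tendsto_scaleR[OF s0 tendsto_const, of z]
        by (intro autocorrelation_continuous_0 f2) simp
    qed
    show "AE z in lborel. norm (autocorrelation f (s n *\<^sub>R z) * gaussian 1 z) \<le> N * cmod (gaussian 1 z)" for n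
      using norm_autocorrelation_le[OF f2] by (auto simp: norm_mult N_def intro!: mult_right_mono)
  qed measurable
  from tendsto_mult_left[OF this, of "of_real c"]
  have "(\<lambda>n. \<integral>\<zeta>. of_real ((cmod (fourier_integral f \<zeta>))\<^sup>2) * gaussian (s n) \<zeta> \<partial>lborel)
      \<longlonglongrightarrow> of_real c * (\<integral>z. of_real N * gaussian 1 (z :: real ^ 'd) \<partial>lborel)"
    unfolding c_def plancherel_gaussian_regularised[OF f s] .
  \<comment> \<open>The normalised mass of the Gaussian is its transform at 0, which equals
    1.\<close>
  also have "of_real c * (\<integral>z. of_real N * gaussian 1 (z :: real ^ 'd) \<partial>lborel)
      = of_real N * fourier_integral (gaussian 1 :: real ^ 'd \<Rightarrow> complex) 0"
    by (simp add: fourier_integral_def c_def)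
  also have "\<dots> = of_real N"
    by (subst fourier_integral_gaussian) (auto simp: gaussian_def)
  finally have lim: "(\<lambda>n. \<integral>\<zeta>. G n \<zeta> \<partial>lborel) \<longlonglongrightarrow> N"
    unfolding G_of_real by (simp add: tendsto_of_real_iff)
  have G_int: "integrable lborel (G n)" for n
  proof -
    \<comment> \<open>Up to \<open>c\<close>, the squared modulus is the transform of an integrable
      function, hence bounded, and the Gaussian is integrable.\<close>
    have "integrable lborel (\<lambda>\<zeta>. fourier_integral (autocorrelation f) \<zeta> * gaussian (s n) \<zeta>)"
    proof (rule Bochner_Integration.integrable_bound)
      let ?B = "c * (\<integral>x. cmod (autocorrelation f x) \<partial>lborel)"
      show "integrable lborel (\<lambda>\<zeta> :: real ^ 'd. ?B * cmod (gaussian (s n) \<zeta>))"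
        using s[of n] by (intro integrable_mult_right integrable_norm gaussian_integrable) simp
      have "cmod (fourier_integral (autocorrelation f) \<zeta>) \<le> ?B" for \<zeta>
        using integral_norm_bound[of lborel "\<lambda>x. exp (- \<i> * of_real (x \<bullet> \<zeta>)) * autocorrelation f x"]
        by (simp add: fourier_integral_def c_def norm_mult mult_left_mono)
      then show "AE \<zeta> in lborel. norm (fourier_integral (autocorrelation f) \<zeta> * gaussian (s n) \<zeta>)
          \<le> norm (?B * cmod (gaussian (s n) \<zeta>))"
        by (auto simp: norm_mult c_def intro!: mult_right_mono order.trans[OF _ abs_ge_self])
    qed measurable
    from integrable_mult_right[OF this, of "of_real c"]
    have "integrable lborel (\<lambda>\<zeta>. complex_of_real (G n \<zeta>))"
      unfolding G_of_real[symmetric] autocorrelation_transform[OF f] c_def by (simp add: mult_ac)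
    then show ?thesis by (simp add: complex_of_real_integrable_eq)
  qed
  have mono: "mono (\<lambda>n. G n \<zeta>)" for \<zeta>
  proof (rule monoI)
    fix m n :: nat assume "m \<le> n"
    then have "s n \<le> s m" by (simp add: s_def)
    then have "norm (s n *\<^sub>R \<zeta>) \<le> norm (s m *\<^sub>R \<zeta>)"
      using s[of n] by (auto intro: mult_right_mono)
    then show "G m \<zeta> \<le> G n \<zeta>"
      unfolding G_def by (intro mult_left_mono) (auto intro!: power_mono)
  qed
  have pt: "(\<lambda>n. G n \<zeta>) \<longlonglongrightarrow> (cmod (fourier_integral f \<zeta>))\<^sup>2" for \<zeta>
    unfolding G_def by (rule tendsto_eq_intros s0 refl | simp)+
  have "integrable lborel (\<lambda>\<zeta>. (cmod (fourier_integral f \<zeta>))\<^sup>2)"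
    by (rule integrable_monotone_convergence[OF G_int _ _ lim]) (use mono pt in auto)
  then show "square_integrable (fourier_integral f)"
    by (simp add: square_integrable_def)
  show "(\<integral>\<zeta>. (cmod (fourier_integral f \<zeta>))\<^sup>2 \<partial>lborel) = (\<integral>x. (cmod (f x))\<^sup>2 \<partial>lborel)"
    unfolding N_def[symmetric]
    by (rule integral_monotone_convergence[OF G_int _ _ lim]) (use mono pt in auto)
qed

subsection \<open>The Fourier transform on \<open>L\<^sup>2\<close>\<close>

definition truncate :: "real \<Rightarrow> (real ^ 'd \<Rightarrow> complex) \<Rightarrow> real ^ 'd \<Rightarrow> complex" where
  "truncate R f x = indicator (cball 0 R) x * f x"

lemma truncate_measurable [measurable]:
  assumes [measurable]: "f \<in> borel_measurable borel"
  shows "truncate R f \<in> borel_measurable borel"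
proof -
  have [measurable]: "cball 0 R \<in> sets borel" by simp
  show ?thesis unfolding truncate_def[abs_def] by measurable
qed

lemma truncate_square_integrable:
  assumes "square_integrable f"
  shows "square_integrable (truncate R f)"
  by (rule square_integrable_bound[OF assms, of _ 1])
     (auto simp: truncate_measurable square_integrable_measurable assms truncate_def indicator_def)

text \<open>A ball has finite measure, so its indicator lies in L2 and the truncation is a product
  of two L2 functions.\<close>

lemma truncate_integrable:
  assumes "square_integrable f"
  shows "integrable lborel (truncate R f)"
proof -
  have "square_integrable (indicator (cball 0 R) :: real ^ 'd \<Rightarrow> complex)"
  proof -
    have eq: "(cmod (indicator (cball 0 R) x))\<^sup>2 = indicator (cball 0 R) x" for x :: "real ^ 'd"
      by (simp add: indicator_def)
    show ?thesis
      unfolding square_integrable_def eq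
      using emeasure_bounded_finite[OF bounded_cball]
      by (auto simp: integrable_indicator_iff intro!: borel_measurable_indicator)
  qed
  from square_integrable_mult_integrable[OF this assms] show ?thesis
    by (simp add: truncate_def[abs_def])
qed

lemma truncate_tendsto:
  fixes f :: "real ^ 'd \<Rightarrow> complex"
  assumes f: "square_integrable f"
  shows "((\<lambda>R. \<integral>x. (cmod (truncate R f x - f x))\<^sup>2 \<partial>lborel) \<longlongrightarrow> 0) at_top"
proof -
  have [measurable]: "f \<in> borel_measurable borel"
    using f by (rule square_integrable_measurable)
  have "((\<lambda>R. \<integral>x. (cmod (truncate R f x - f x))\<^sup>2 \<partial>lborel) \<longlongrightarrow> (\<integral>x. 0 \<partial>(lborel :: (real ^ 'd) measure))) at_top"
  proof (rule integral_dominated_convergence_at_top)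
    show "integrable lborel (\<lambda>x. (cmod (f x))\<^sup>2)"
      by (rule square_integrable_norm_integrable[OF f])
    show "\<forall>\<^sub>F R in at_top. AE x in lborel. norm ((cmod (truncate R f x - f x))\<^sup>2) \<le> (cmod (f x))\<^sup>2"
      by (auto simp: truncate_def indicator_def)
    show "AE x in lborel. ((\<lambda>R. (cmod (truncate R f x - f x))\<^sup>2) \<longlongrightarrow> 0) at_top"
    proof (rule AE_I2)
      fix x
      have "\<forall>\<^sub>F R in at_top. (cmod (truncate R f x - f x))\<^sup>2 = 0"
        using eventually_ge_at_top[of "norm x"]
        by eventually_elim (simp add: truncate_def)
      then show "((\<lambda>R. (cmod (truncate R f x - f x))\<^sup>2) \<longlongrightarrow> 0) at_top"
        by (rule tendsto_eventually)
    qed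
  qed measurable
  then show ?thesis by simp
qed

text \<open>Squared distances avoid square roots at the price of the factor 2, harmless where only
  convergence to 0 matters.\<close>

lemma l2_dist_sq_le:
  assumes "square_integrable f" "square_integrable g" "square_integrable h"
  shows "(\<integral>x. (cmod (f x - h x))\<^sup>2 \<partial>lborel)
    \<le> 2 * (\<integral>x. (cmod (f x - g x))\<^sup>2 \<partial>lborel) + 2 * (\<integral>x. (cmod (g x - h x))\<^sup>2 \<partial>lborel)"
proof -
  note sq = square_integrable_norm_integrable[OF square_integrable_diff]
  have "(\<integral>x. (cmod (f x - h x))\<^sup>2 \<partial>lborel)
      \<le> (\<integral>x. 2 * (cmod (f x - g x))\<^sup>2 + 2 * (cmod (g x - h x))\<^sup>2 \<partial>lborel)"
  proof (rule integral_mono)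
    fix x
    show "(cmod (f x - h x))\<^sup>2 \<le> 2 * (cmod (f x - g x))\<^sup>2 + 2 * (cmod (g x - h x))\<^sup>2"
      using cmod_diff_sq_le[of "f x - g x" "h x - g x"] by (simp add: norm_minus_commute)
  qed (intro sq assms Bochner_Integration.integrable_add integrable_mult_right)+
  then show ?thesis by (simp add: sq assms)
qed

text \<open>A relation, since \<open>g\<close> is determined only almost everywhere. Real integrals
  replace the nonnegative ones in \<open>fourier\<close>; they agree because every function involved
  is square-integrable.\<close>

definition is_fourier :: "(real ^ 'd \<Rightarrow> complex) \<Rightarrow> (real ^ 'd \<Rightarrow> complex) \<Rightarrow> bool" where
  "is_fourier f g \<longleftrightarrow> square_integrable f \<and> square_integrable g \<and>
    ((\<lambda>R. \<integral>\<zeta>. (cmod (fourier_integral (truncate R f) \<zeta> - g \<zeta>))\<^sup>2 \<partial>lborel) \<longlongrightarrow> 0) at_top"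

lemma fourier_truncate_square_integrable:
  "square_integrable f \<Longrightarrow> square_integrable (fourier_integral (truncate R f))"
  by (intro plancherel_L1_L2 truncate_integrable truncate_square_integrable)

text \<open>Differences of truncations lie in L1 and L2, so Plancherel's identity turns the distance
  of the transforms into one of truncations. This is the Cauchy property behind the limit in
  mean.\<close>

lemma fourier_truncate_dist:
  assumes f: "square_integrable f"
  shows "(\<integral>\<zeta>. (cmod (fourier_integral (truncate R f) \<zeta> - fourier_integral (truncate S f) \<zeta>))\<^sup>2 \<partial>lborel)
    \<le> 2 * (\<integral>x. (cmod (truncate R f x - f x))\<^sup>2 \<partial>lborel) + 2 * (\<integral>x. (cmod (truncate S f x - f x))\<^sup>2 \<partial>lborel)"
proof -
  note i = truncate_integrable[OF f] and s = truncate_square_integrable[OF f]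
  have "(\<integral>\<zeta>. (cmod (fourier_integral (truncate R f) \<zeta> - fourier_integral (truncate S f) \<zeta>))\<^sup>2 \<partial>lborel)
      = (\<integral>x. (cmod (truncate R f x - truncate S f x))\<^sup>2 \<partial>lborel)"
    using plancherel_L1_L2(2)[OF Bochner_Integration.integrable_diff[OF i[of R] i[of S]]
        square_integrable_diff[OF s[of R] s[of S]]]
    by (simp add: fourier_integral_diff[OF i i])
  also have "\<dots> \<le> 2 * (\<integral>x. (cmod (truncate R f x - f x))\<^sup>2 \<partial>lborel)
      + 2 * (\<integral>x. (cmod (f x - truncate S f x))\<^sup>2 \<partial>lborel)"
    by (rule l2_dist_sq_le) (use f s in auto)
  finally show ?thesis by (simp add: norm_minus_commute)
qed

text \<open>\<open>l2_complete_fast\<close> wants a rapidly converging sequence, so radii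
  \<open>r n\<close> are chosen by the size of the tail; they need not grow. A bound by
  \<open>tail R\<close> alone then extends the convergence to all radii.\<close>

lemma is_fourier_exists:
  assumes f: "square_integrable f"
  obtains g where "is_fourier f g"
proof -
  define tail where "tail R = (\<integral>x. (cmod (truncate R f x - f x))\<^sup>2 \<partial>lborel)" for R
  have tail: "(tail \<longlongrightarrow> 0) at_top"
    unfolding tail_def by (rule truncate_tendsto[OF f])
  \<comment> \<open>Division by 4 makes the sum of two doubled tails at most
    \<open>(1/16) ^ n\<close>, the rate that \<open>l2_complete_fast\<close> asks for.\<close>
  have "\<exists>R. tail R < (1/16) ^ n / 4" for n
    using order_tendstoD(2)[OF tail, of "(1/16) ^ n / 4"]
    by (auto dest!: eventually_happens)
  then obtain r where r: "\<And>n. tail (r n) < (1/16) ^ n / 4" by metis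
  let ?F = "\<lambda>R. fourier_integral (truncate R f)"
  have F: "square_integrable (?F R)" for R
    by (rule fourier_truncate_square_integrable[OF f])
  have dist: "(\<integral>\<zeta>. (cmod (?F R \<zeta> - ?F S \<zeta>))\<^sup>2 \<partial>lborel) \<le> 2 * tail R + 2 * tail S" for R S
    unfolding tail_def by (rule fourier_truncate_dist[OF f])
  have "(\<integral>\<zeta>. (cmod (?F (r (Suc n)) \<zeta> - ?F (r n) \<zeta>))\<^sup>2 \<partial>lborel) \<le> (1/16) ^ n" for n
    using dist[of "r (Suc n)" "r n"] r[of "Suc n"] r[of n] zero_le_power[of "1/16 :: real" n]
    unfolding power_Suc by linarith
  from l2_complete_fast[OF F this]
  obtain g where g: "square_integrable g" "(\<lambda>n. \<integral>\<zeta>. (cmod (?F (r n) \<zeta> - g \<zeta>))\<^sup>2 \<partial>lborel) \<longlonglongrightarrow> 0"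
    by blast
  have "(\<lambda>n. tail (r n)) \<longlonglongrightarrow> 0"
  proof (rule tendsto_sandwich[OF _ _ tendsto_const])
    show "(\<lambda>n. (1/16) ^ n / 4 :: real) \<longlonglongrightarrow> 0"
      by (auto intro!: tendsto_eq_intros LIMSEQ_power_zero)
    show "\<forall>\<^sub>F n in sequentially. 0 \<le> tail (r n)"
      by (simp add: tail_def)
    show "\<forall>\<^sub>F n in sequentially. tail (r n) \<le> (1/16) ^ n / 4"
      using r by (simp add: less_imp_le)
  qed
  \<comment> \<open>Comparing with the radius \<open>r n\<close> and letting \<open>n\<close> tend
    to infinity leaves only \<open>2 * (2 * tail R)\<close>.\<close>
  have bound: "(\<integral>\<zeta>. (cmod (?F R \<zeta> - g \<zeta>))\<^sup>2 \<partial>lborel) \<le> 4 * tail R" for R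
  proof (rule LIMSEQ_le_const)
    have "(\<lambda>n. 2 * (2 * tail R + 2 * tail (r n)) + 2 * (\<integral>\<zeta>. (cmod (?F (r n) \<zeta> - g \<zeta>))\<^sup>2 \<partial>lborel))
        \<longlonglongrightarrow> 2 * (2 * tail R + 2 * 0) + 2 * 0"
      by (intro tendsto_intros g(2)) fact
    then show "(\<lambda>n. 2 * (2 * tail R + 2 * tail (r n)) + 2 * (\<integral>\<zeta>. (cmod (?F (r n) \<zeta> - g \<zeta>))\<^sup>2 \<partial>lborel))
        \<longlonglongrightarrow> 4 * tail R"
      by simp
    have "(\<integral>\<zeta>. (cmod (?F R \<zeta> - g \<zeta>))\<^sup>2 \<partial>lborel)
        \<le> 2 * (2 * tail R + 2 * tail (r n)) + 2 * (\<integral>\<zeta>. (cmod (?F (r n) \<zeta> - g \<zeta>))\<^sup>2 \<partial>lborel)" for n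
      by (rule order.trans[OF l2_dist_sq_le[OF F[of R] F[of "r n"] g(1)]
            add_right_mono[OF mult_left_mono[OF dist]]]) simp
    then show "\<exists>N. \<forall>n\<ge>N. (\<integral>\<zeta>. (cmod (?F R \<zeta> - g \<zeta>))\<^sup>2 \<partial>lborel)
        \<le> 2 * (2 * tail R + 2 * tail (r n)) + 2 * (\<integral>\<zeta>. (cmod (?F (r n) \<zeta> - g \<zeta>))\<^sup>2 \<partial>lborel)"
      by blast
  qed
  have "((\<lambda>R. \<integral>\<zeta>. (cmod (?F R \<zeta> - g \<zeta>))\<^sup>2 \<partial>lborel) \<longlongrightarrow> 0) at_top"
  proof (rule tendsto_sandwich[OF _ _ tendsto_const])
    show "((\<lambda>R. 4 * tail R) \<longlongrightarrow> 0) at_top"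
      using tail by (rule tendsto_mult_right_zero)
  qed (use bound in auto)
  with f g(1) have "is_fourier f g" by (simp add: is_fourier_def)
  then show ?thesis by (rule that)
qed

lemma is_fourier_norm:
  assumes "is_fourier f g"
  shows "(\<integral>\<zeta>. (cmod (g \<zeta>))\<^sup>2 \<partial>lborel) = (\<integral>x. (cmod (f x))\<^sup>2 \<partial>lborel)"
proof -
  have f: "square_integrable f" and g: "square_integrable g"
    and lim: "((\<lambda>R. \<integral>\<zeta>. (cmod (fourier_integral (truncate R f) \<zeta> - g \<zeta>))\<^sup>2 \<partial>lborel) \<longlongrightarrow> 0) at_top"
    using assms by (auto simp: is_fourier_def)
  have "((\<lambda>R. \<integral>x. (cmod (truncate R f x))\<^sup>2 \<partial>lborel) \<longlongrightarrow> (\<integral>\<zeta>. (cmod (g \<zeta>))\<^sup>2 \<partial>lborel)) at_top"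
    using l2_tendsto_norm[OF fourier_truncate_square_integrable[OF f] g lim]
    by (simp add: plancherel_L1_L2(2) truncate_integrable truncate_square_integrable f)
  moreover have "((\<lambda>R. \<integral>x. (cmod (truncate R f x))\<^sup>2 \<partial>lborel) \<longlongrightarrow> (\<integral>x. (cmod (f x))\<^sup>2 \<partial>lborel)) at_top"
    by (intro l2_tendsto_norm truncate_square_integrable truncate_tendsto f)
  ultimately show ?thesis
    by (intro tendsto_unique) auto
qed

text \<open>Both sides are limits of the same numbers, by \<open>fourier_integral_adjoint\<close>
  for the truncations.\<close>

lemma is_fourier_adjoint:
  assumes fg: "is_fourier f g" and kl: "is_fourier k l"
  shows "(\<integral>\<zeta>. g \<zeta> * k \<zeta> \<partial>lborel) = (\<integral>x. f x * l x \<partial>lborel)"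
proof -
  have sq: "square_integrable f" "square_integrable g" "square_integrable k" "square_integrable l"
    and lim: "((\<lambda>R. \<integral>\<zeta>. (cmod (fourier_integral (truncate R f) \<zeta> - g \<zeta>))\<^sup>2 \<partial>lborel) \<longlongrightarrow> 0) at_top"
      "((\<lambda>R. \<integral>\<zeta>. (cmod (fourier_integral (truncate R k) \<zeta> - l \<zeta>))\<^sup>2 \<partial>lborel) \<longlongrightarrow> 0) at_top"
    using fg kl by (auto simp: is_fourier_def)
  have "((\<lambda>R. \<integral>\<zeta>. fourier_integral (truncate R f) \<zeta> * truncate R k \<zeta> \<partial>lborel) \<longlongrightarrow> (\<integral>\<zeta>. g \<zeta> * k \<zeta> \<partial>lborel)) at_top"
    by (intro l2_tendsto_integral_mult fourier_truncate_square_integrable truncate_square_integrable truncate_tendsto sq lim)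
  moreover have "((\<lambda>R. \<integral>x. truncate R f x * fourier_integral (truncate R k) x \<partial>lborel) \<longlongrightarrow> (\<integral>x. f x * l x \<partial>lborel)) at_top"
    by (intro l2_tendsto_integral_mult fourier_truncate_square_integrable truncate_square_integrable truncate_tendsto sq lim)
  ultimately show ?thesis
    by (intro tendsto_unique) (auto simp: fourier_integral_adjoint truncate_integrable sq)
qed

text \<open>Differences reduce equality almost everywhere to a vanishing norm, where the isometry
  applies.\<close>

lemma is_fourier_diff:
  assumes fg: "is_fourier f g" and kl: "is_fourier k l"
  shows "is_fourier (\<lambda>x. f x - k x) (\<lambda>\<zeta>. g \<zeta> - l \<zeta>)"
proof -
  let ?F = "\<lambda>f R. fourier_integral (truncate R f)"
  have sq: "square_integrable f" "square_integrable g" "square_integrable k" "square_integrable l"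
    and lim: "((\<lambda>R. \<integral>\<zeta>. (cmod (?F f R \<zeta> - g \<zeta>))\<^sup>2 \<partial>lborel) \<longlongrightarrow> 0) at_top"
      "((\<lambda>R. \<integral>\<zeta>. (cmod (?F k R \<zeta> - l \<zeta>))\<^sup>2 \<partial>lborel) \<longlongrightarrow> 0) at_top"
    using fg kl by (auto simp: is_fourier_def)
  have tr: "truncate R (\<lambda>x. f x - k x) = (\<lambda>x. truncate R f x - truncate R k x)" for R
    by (auto simp: truncate_def right_diff_distrib)
  have eq: "?F (\<lambda>x. f x - k x) R \<zeta> = ?F f R \<zeta> - ?F k R \<zeta>" for R \<zeta>
    unfolding tr by (intro fourier_integral_diff truncate_integrable sq)
  note sqF = fourier_truncate_square_integrable[OF sq(1)] fourier_truncate_square_integrable[OF sq(3)]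
  have "((\<lambda>R. \<integral>\<zeta>. (cmod (?F (\<lambda>x. f x - k x) R \<zeta> - (g \<zeta> - l \<zeta>)))\<^sup>2 \<partial>lborel) \<longlongrightarrow> 0) at_top"
  proof (rule tendsto_sandwich[OF _ _ tendsto_const])
    show "((\<lambda>R. 2 * (\<integral>\<zeta>. (cmod (?F f R \<zeta> - g \<zeta>))\<^sup>2 \<partial>lborel) + 2 * (\<integral>\<zeta>. (cmod (?F k R \<zeta> - l \<zeta>))\<^sup>2 \<partial>lborel)) \<longlongrightarrow> 0) at_top"
      by (rule tendsto_eq_intros lim refl | simp)+
    have "(\<integral>\<zeta>. (cmod (?F f R \<zeta> - ?F k R \<zeta> - (g \<zeta> - l \<zeta>)))\<^sup>2 \<partial>lborel)
      \<le> (\<integral>\<zeta>. 2 * (cmod (?F f R \<zeta> - g \<zeta>))\<^sup>2 + 2 * (cmod (?F k R \<zeta> - l \<zeta>))\<^sup>2 \<partial>lborel)" for R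
    proof (rule integral_mono)
      fix \<zeta>
      have "?F f R \<zeta> - ?F k R \<zeta> - (g \<zeta> - l \<zeta>) = (?F f R \<zeta> - g \<zeta>) - (?F k R \<zeta> - l \<zeta>)" by simp
      then show "(cmod (?F f R \<zeta> - ?F k R \<zeta> - (g \<zeta> - l \<zeta>)))\<^sup>2
          \<le> 2 * (cmod (?F f R \<zeta> - g \<zeta>))\<^sup>2 + 2 * (cmod (?F k R \<zeta> - l \<zeta>))\<^sup>2"
        by (simp only: cmod_diff_sq_le)
    qed (intro square_integrable_norm_integrable square_integrable_diff sq sqF
        Bochner_Integration.integrable_add integrable_mult_right)+
    also have "\<dots> R = 2 * (\<integral>\<zeta>. (cmod (?F f R \<zeta> - g \<zeta>))\<^sup>2 \<partial>lborel) + 2 * (\<integral>\<zeta>. (cmod (?F k R \<zeta> - l \<zeta>))\<^sup>2 \<partial>lborel)" for R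
      by (simp add: square_integrable_norm_integrable square_integrable_diff sq sqF)
    finally show "\<forall>\<^sub>F R in at_top. (\<integral>\<zeta>. (cmod (?F (\<lambda>x. f x - k x) R \<zeta> - (g \<zeta> - l \<zeta>)))\<^sup>2 \<partial>lborel)
      \<le> 2 * (\<integral>\<zeta>. (cmod (?F f R \<zeta> - g \<zeta>))\<^sup>2 \<partial>lborel) + 2 * (\<integral>\<zeta>. (cmod (?F k R \<zeta> - l \<zeta>))\<^sup>2 \<partial>lborel)"
      unfolding eq by simp
  qed simp
  then show ?thesis
    by (simp add: is_fourier_def square_integrable_diff sq)
qed

section \<open>Uniqueness, injectivity and surjectivity\<close>

lemma square_integrable_AE_zero_iff:
  assumes "square_integrable f"
  shows "(\<integral>x. (cmod (f x))\<^sup>2 \<partial>lborel) = 0 \<longleftrightarrow> (AE x in lborel. f x = 0)"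
  using integral_nonneg_eq_0_iff_AE[OF square_integrable_norm_integrable[OF assms]] by simp

text \<open>The isometry applied to the difference. From left to right this is uniqueness of the
  transform, from right to left injectivity.\<close>

lemma is_fourier_AE_iff:
  assumes "is_fourier f g" "is_fourier k l"
  shows "(AE x in lborel. f x = k x) \<longleftrightarrow> (AE \<zeta> in lborel. g \<zeta> = l \<zeta>)"
proof -
  have d: "is_fourier (\<lambda>x. f x - k x) (\<lambda>\<zeta>. g \<zeta> - l \<zeta>)"
    by (rule is_fourier_diff[OF assms])
  then have "square_integrable (\<lambda>x. f x - k x)" "square_integrable (\<lambda>\<zeta>. g \<zeta> - l \<zeta>)"
    by (auto simp: is_fourier_def)
  from this[THEN square_integrable_AE_zero_iff] is_fourier_norm[OF d] show ?thesis
    by simp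
qed

text \<open>Serves the passage to classes, where \<open>rep_l2 (abs_l2 f)\<close> agrees with
  \<open>f\<close> only almost everywhere. Changing \<open>f\<close> on a null set leaves the
  transforms of its truncations unchanged at every point.\<close>

lemma is_fourier_cong:
  assumes fg: "is_fourier f g" and sq: "square_integrable f'" "square_integrable g'"
    and f: "AE x in lborel. f x = f' x" and g: "AE \<zeta> in lborel. g \<zeta> = g' \<zeta>"
  shows "is_fourier f' g'"
proof -
  have [measurable]: "f \<in> borel_measurable borel" "g \<in> borel_measurable borel"
      "f' \<in> borel_measurable borel" "g' \<in> borel_measurable borel"
    using fg sq by (auto simp: is_fourier_def square_integrable_measurable)
  have eq: "fourier_integral (truncate R f') = fourier_integral (truncate R f)" for R
    unfolding fourier_integral_def[abs_def]
    by (intro ext arg_cong[where f="times _"] integral_cong_AE; (measurable)?)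
       (use f in \<open>auto simp: truncate_def elim!: eventually_mono\<close>)
  have "(\<integral>\<zeta>. (cmod (fourier_integral (truncate R f) \<zeta> - g' \<zeta>))\<^sup>2 \<partial>lborel)
      = (\<integral>\<zeta>. (cmod (fourier_integral (truncate R f) \<zeta> - g \<zeta>))\<^sup>2 \<partial>lborel)" for R
    by (intro integral_cong_AE; (measurable)?) (use g in \<open>auto elim!: eventually_mono\<close>)
  then show ?thesis
    using fg sq by (simp add: is_fourier_def eq)
qed

text \<open>Since the transform is isometric, its adjoint, which is the transform conjugated by complex
  conjugation, is a left inverse; conjugating once more shows that it is a right inverse.\<close>

lemma is_fourier_surj:
  assumes g: "square_integrable g"
  obtains f where "is_fourier f g"
proof -
  obtain k where k: "is_fourier (\<lambda>x. cnj (g x)) k"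
    using is_fourier_exists[OF square_integrable_cnj[OF g]] .
  then have sqk: "square_integrable k" by (simp add: is_fourier_def)
  let ?f = "\<lambda>x. cnj (k x)"
  have sqf: "square_integrable ?f" by (rule square_integrable_cnj[OF sqk])
  obtain h where h: "is_fourier ?f h" using is_fourier_exists[OF sqf] .
  then have sqh: "square_integrable h" by (simp add: is_fourier_def)
  define N where "N = (\<integral>x. (cmod (g x))\<^sup>2 \<partial>lborel)"
  have Nk: "(\<integral>x. (cmod (k x))\<^sup>2 \<partial>lborel) = N"
    using is_fourier_norm[OF k] by (simp add: N_def)
  have Nh: "(\<integral>x. (cmod (h x))\<^sup>2 \<partial>lborel) = N"
    using is_fourier_norm[OF h] Nk by simp
  have "(\<integral>x. h x * cnj (g x) \<partial>lborel) = (\<integral>x. cnj (k x) * k x \<partial>lborel)"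
    by (rule is_fourier_adjoint[OF h k])
  also have "\<dots> = (\<integral>x. complex_of_real ((cmod (k x))\<^sup>2) \<partial>lborel)"
    by (simp only: complex_norm_square mult.commute)
  also have "\<dots> = of_real N"
    by (simp add: Nk del: of_real_power)
  finally have hg: "(\<integral>x. h x * cnj (g x) \<partial>lborel) = of_real N" .
  have int: "integrable lborel (\<lambda>x. h x * cnj (g x))"
    by (rule square_integrable_mult_integrable[OF sqh square_integrable_cnj[OF g]])
  \<comment> \<open>The equality case of Cauchy-Schwarz: both squared norms and the inner product of
    \<open>h\<close> and \<open>g\<close> equal \<open>N\<close>, so the squared distance is
    \<open>N + N - 2 * N\<close>.\<close>
  have "(cmod (h x - g x))\<^sup>2 = (cmod (h x))\<^sup>2 + (cmod (g x))\<^sup>2 - 2 * Re (h x * cnj (g x))" for x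
    by (simp only: cmod_power2) (simp add: power2_eq_square algebra_simps)
  then have "(\<integral>x. (cmod (h x - g x))\<^sup>2 \<partial>lborel) = N + N - 2 * Re (of_real N)"
    using square_integrable_norm_integrable[OF sqh] square_integrable_norm_integrable[OF g] int
    by (simp only: Bochner_Integration.integral_diff Bochner_Integration.integral_add
        Bochner_Integration.integrable_add integrable_mult_right integral_mult_right_zero
        integrable_Re integral_Re hg Nh N_def[symmetric])
  then have "AE x in lborel. h x = g x"
    using square_integrable_AE_zero_iff[OF square_integrable_diff[OF sqh g]] by simp
  then have "is_fourier ?f g"
    by (intro is_fourier_cong[OF h sqf g]) auto
  then show ?thesis by (rule that)
qed

subsection \<open>The splitting scheme\<close>

lemma l2_rel_rep: "l2_rel (rep_l2 v) (rep_l2 v)"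
  by (rule Quotient_rep_reflp[OF Quotient_l2])

lemma square_integrable_rep: "square_integrable (rep_l2 v)"
  using l2_rel_rep[of v] by (simp add: l2_rel_def)

lemma l2_eqI: "(AE x in lborel. rep_l2 v x = rep_l2 w x) \<Longrightarrow> v = w"
  using Quotient_rel_rep[OF Quotient_l2, of v w] square_integrable_rep
  by (auto simp: l2_rel_def)

lemma rep_abs_l2:
  assumes "square_integrable f"
  shows "AE x in lborel. rep_l2 (abs_l2 f) x = f x"
  using Quotient_rep_abs[OF Quotient_l2, of f] assms by (auto simp: l2_rel_def)

lemma l2_norm_abs:
  assumes "square_integrable f"
  shows "l2_norm (abs_l2 f) = sqrt (\<integral>x. (cmod (f x))\<^sup>2 \<partial>lborel)"
  using assms by (subst l2_norm.abs_eq) (auto simp: l2_rel_def)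

text \<open>Resolves the definite description: existence comes from
  \<open>is_fourier_exists\<close>, and uniqueness up to null sets is equality of classes.\<close>

lemma fourier_eq_iff:
  "fourier v = w \<longleftrightarrow> is_fourier (rep_l2 v) (rep_l2 w)"
proof -
  let ?P = "\<lambda>g. ((\<lambda>R::real. \<integral>\<^sup>+ \<zeta>.
         ennreal ((cmod (fourier_integral (\<lambda>x. indicator (cball 0 R) x * rep_l2 v x) \<zeta>
           - rep_l2 g \<zeta>))\<^sup>2) \<partial>lborel) \<longlongrightarrow> 0) at_top"
  have P: "?P g \<longleftrightarrow> is_fourier (rep_l2 v) (rep_l2 g)" for g
  proof -
    have tr: "(\<lambda>x. indicator (cball 0 R) x * rep_l2 v x) = truncate R (rep_l2 v)" for R
      by (simp add: truncate_def fun_eq_iff)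
    have sq: "square_integrable (\<lambda>\<zeta>. fourier_integral (truncate R (rep_l2 v)) \<zeta> - rep_l2 g \<zeta>)" for R
      by (intro square_integrable_diff fourier_truncate_square_integrable square_integrable_rep)
    show ?thesis
      \<comment> \<open>The nonnegative integrals are finite, hence images of real ones; writing the
        limit as \<open>ennreal 0\<close> moves the convergence to the reals.\<close>
      unfolding tr square_integrable_nn_integral[OF sq] is_fourier_def ennreal_0[symmetric]
      by (subst tendsto_ennreal_iff) (auto simp: square_integrable_rep simp del: ennreal_0)
  qed
  obtain g where g: "is_fourier (rep_l2 v) g"
    using is_fourier_exists[OF square_integrable_rep] .
  then have sqg: "square_integrable g" by (simp add: is_fourier_def)
  have "is_fourier (rep_l2 v) (rep_l2 (abs_l2 g))"
    by (rule is_fourier_cong[OF g square_integrable_rep square_integrable_rep])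
       (use rep_abs_l2[OF sqg] in auto)
  then have ex: "?P (abs_l2 g)" by (simp only: P)
  have un: "w = w'" if "?P w" "?P w'" for w w'
    using is_fourier_AE_iff[of "rep_l2 v" "rep_l2 w" "rep_l2 v" "rep_l2 w'"] that
    by (intro l2_eqI) (simp add: P)
  have "?P (fourier v)"
    unfolding fourier_def by (rule theI[of ?P, OF ex]) (rule un[OF _ ex])
  then show ?thesis
    using un P by blast
qed

lemma l2_norm_fourier: "l2_norm (fourier v) = l2_norm v"
  using is_fourier_norm[of "rep_l2 v" "rep_l2 (fourier v)"] fourier_eq_iff[of v "fourier v"]
  by (simp add: l2_norm.rep_eq)

lemma bij_fourier: "bij (fourier :: 'd::finite l2 \<Rightarrow> 'd l2)"
proof (rule bijI)
  show "inj (fourier :: 'd l2 \<Rightarrow> 'd l2)"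
  proof (rule injI)
    fix v w :: "'d l2" assume "fourier v = fourier w"
    then have "is_fourier (rep_l2 v) (rep_l2 (fourier v))" "is_fourier (rep_l2 w) (rep_l2 (fourier v))"
      by (simp_all flip: fourier_eq_iff)
    from is_fourier_AE_iff[OF this] show "v = w" by (intro l2_eqI) simp
  qed
  show "surj (fourier :: 'd l2 \<Rightarrow> 'd l2)"
    unfolding surj_def
  proof (rule allI)
    fix w :: "'d l2"
    obtain f where f: "is_fourier f (rep_l2 w)"
      using is_fourier_surj[OF square_integrable_rep] .
    then have "square_integrable f" by (simp add: is_fourier_def)
    from rep_abs_l2[OF this] have "is_fourier (rep_l2 (abs_l2 f)) (rep_l2 w)"
      by (intro is_fourier_cong[OF f square_integrable_rep square_integrable_rep]) auto
    then have "fourier (abs_l2 f) = w" by (simp add: fourier_eq_iff)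
    then show "\<exists>v. w = fourier v" by blast
  qed
qed

lemma l2_norm_free_multiplier: "l2_norm (free_multiplier b v) = l2_norm v"
  by transfer (simp add: norm_mult)

text \<open>Bijectivity of \<open>fourier\<close> makes the defining equation uniquely solvable, so
  \<open>THE\<close> returns its solution. The norm then passes through \<open>fourier\<close>, the
  unimodular multiplier and \<open>fourier\<close> again.\<close>

lemma l2_norm_propagator: "l2_norm (propagator b t s v) = l2_norm v"
proof -
  have "\<exists>!w. fourier w = free_multiplier (b t - b s) (fourier v)"
    using bij_fourier unfolding bij_iff by blast
  from theI'[OF this] have "fourier (propagator b t s v) = free_multiplier (b t - b s) (fourier v)"
    by (simp add: propagator_def)
  then show ?thesis
    by (metis l2_norm_fourier l2_norm_free_multiplier)
qed

text \<open>The potential is real, so the phase has modulus one. Measurability of \<open>V\<close>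
  makes the phase measurable through the parametrised integral, so \<open>abs_l2\<close> is applied
  to a square-integrable function, where its value is determined.\<close>

lemma l2_norm_nonlinear_flow:
  assumes V: "V \<in> borel_measurable borel"
  shows "l2_norm (nonlinear_flow V t u) = l2_norm u"
proof -
  have [measurable]: "rep_l2 u \<in> borel_measurable borel" "V \<in> borel_measurable borel"
    using square_integrable_rep[of u] V by (auto simp: square_integrable_measurable)
  have [measurable]: "potential V u \<in> borel_measurable borel"
    unfolding potential_def[abs_def] by measurable
  let ?f = "\<lambda>x. exp (\<i> * of_real (t * potential V u x)) * rep_l2 u x"
  have norm: "cmod (?f x) = cmod (rep_l2 u x)" for x
    by (simp add: norm_mult)
  have "square_integrable ?f"
    by (rule square_integrable_bound[OF square_integrable_rep[of u], where c=1]) (measurable, simp only: norm mult_1 order_refl)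
  from l2_norm_abs[OF this] show ?thesis
    by (simp only: nonlinear_flow_def norm l2_norm.rep_eq)
qed

theorem proposition4:
  fixes V :: "real ^ 'd \<Rightarrow> real"
    and M :: "'w measure" and F :: "real \<Rightarrow> 'w measure" and \<beta> :: "real \<Rightarrow> 'w \<Rightarrow> real"
    and u0 :: "'d l2" and \<tau> :: real and u :: "nat \<Rightarrow> 'w \<Rightarrow> 'd l2"
  assumes "continuous_on UNIV V" and "bounded (range V)"
    and "standard_brownian_motion M F \<beta>"
    and "0 < \<tau>" and "\<tau> < 1"
    and "AE \<omega> in M. u 0 \<omega> = u0"
    and "\<forall>n. AE \<omega> in M. u (Suc n) \<omega> =
           propagator (\<lambda>t. \<beta> t \<omega>) (real (Suc n) * \<tau>) (real n * \<tau>)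
             (nonlinear_flow V \<tau> (u n \<omega>))"
  shows "\<forall>n\<ge>1. AE \<omega> in M. l2_norm (u n \<omega>) = l2_norm u0"
proof -
  have V: "V \<in> borel_measurable borel"
    using assms(1) by (rule borel_measurable_continuous_onI)
  \<comment> \<open>The exceptional null set depends on \<open>n\<close>: each induction step adds
    that of one recurrence. Including \<open>n = 0\<close> lets the initial condition start the
    induction.\<close>
  have "AE \<omega> in M. l2_norm (u n \<omega>) = l2_norm u0" for n
  proof (induction n)
    case 0
    from assms(6) show ?case by eventually_elim simp
  next
    case (Suc n)
    from Suc assms(7)[rule_format, of n] show ?case
      by eventually_elim (simp only: l2_norm_propagator l2_norm_nonlinear_flow[OF V])
  qed
  then show ?thesis by blast
qed

end
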